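(* Let $p=2$ (with $\alpha>0$, $\beta>0$). For any fixed $\omega>0$, $$\mathcal G_{\gamma(\omega),\gamma(\omega),\gamma(\omega)}=\Big\{\big(e^{i\theta_1}\psi_\omega(\cdot+y),\,e^{i\theta_2}\psi_\omega(\cdot+y),\,e^{i(\theta_1+\theta_2)}\psi_\omega(\cdot+y)\big):\theta_1,\theta_2,y\in\mathbb R\Big\},$$ where $$\gamma(\omega)=\frac{12\sqrt2\,\omega^{3/2}}{(\alpha+\beta)^2},\qquad \psi_\omega(x)=\frac{3\omega}{\alpha+\beta}\,\mathrm{sech}^2\Big(\tfrac12\sqrt{2\omega}\,x\Big).$$
   Context: Fix $\alpha>0$, $\beta>0$. $H^1(\mathbb R;\mathbb C^3)$ is the product of three copies of $H^1(\mathbb R,\mathbb C)$; write $\vec u=(u_1,u_2,u_3)$. For $p=2$ the energy is $$E(\vec u)=\sum_{i=1}^3\Big\{\frac12\int_{\mathbb R}|\partial_xu_i|^2dx-\frac{\beta}{3}\int_{\mathbb R}|u_i|^{3}dx\Big\}-\alpha\,\mathrm{Re}\int_{\mathbb R}u_1u_2\overline{u_3}\,dx .$$ Define $I(\gamma,\mu,s)=\inf\{E(\vec u):\vec u\in H^1(\mathbb R;\mathbb C^3),\ \|u_1\|_{L^2}^2=\gamma,\ \|u_2\|_{L^2}^2=\mu,\ \|u_3\|_{L^2}^2=s\}$, and let $\mathcal G_{\gamma,\mu,s}$ be the set of all $\vec u\in H^1(\mathbb R;\mathbb C^3)$ with $\|u_1\|_{L^2}^2=\gamma$, $\|u_2\|_{L^2}^2=\mu$,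 $\|u_3\|_{L^2}^2=s$ and $E(\vec u)=I(\gamma,\mu,s)$. *)

theory Defs
  imports "HOL-Analysis.Analysis"
begin

text \<open>Elements of \<open>L\<^sup>2\<close> and \<open>H\<^sup>1\<close> are represented by functions on the line, and no
  quotient by almost-everywhere equality is formed. All sets of functions below are closed under
  almost-everywhere equality; this is why measurability and integrals refer to the complete
  measure \<open>lebesgue\<close>.\<close>

definition test_function :: "(real \<Rightarrow> real) \<Rightarrow> bool" where
  "test_function \<phi> \<longleftrightarrow>
     (\<forall>n x. (deriv ^^ n) \<phi> field_differentiable at x) \<and> compact (closure {x. \<phi> x \<noteq> 0})"

definition locally_integrable :: "(real \<Rightarrow> complex) \<Rightarrow> bool" where
  "locally_integrable f \<longleftrightarrow> (\<forall>a b. set_integrable lebesgue {a..b} f)"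

text \<open>Local integrability of \<open>f\<close> and \<open>g\<close> makes both integrals proper and determines \<open>g\<close> up to a
  null set. Real-valued test functions suffice, by linearity.\<close>

definition has_weak_deriv :: "(real \<Rightarrow> complex) \<Rightarrow> (real \<Rightarrow> complex) \<Rightarrow> bool" where
  "has_weak_deriv f g \<longleftrightarrow> locally_integrable f \<and> locally_integrable g \<and>
     (\<forall>\<phi>. test_function \<phi> \<longrightarrow>
        (LINT x|lebesgue. f x * complex_of_real (deriv \<phi> x)) =
        - (LINT x|lebesgue. g x * complex_of_real (\<phi> x)))"

definition weak_deriv :: "(real \<Rightarrow> complex) \<Rightarrow> real \<Rightarrow> complex" where
  "weak_deriv f = (SOME g. has_weak_deriv f g)"

definition L2 :: "(real \<Rightarrow> complex) set" where
  "L2 = {f. f \<in> borel_measurable lebesgue \<and> integrable lebesgue (\<lambda>x. (cmod (f x))\<^sup>2)}"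

definition L2_norm :: "(real \<Rightarrow> complex) \<Rightarrow> real" where
  "L2_norm f = sqrt (LINT x|lebesgue. (cmod (f x))\<^sup>2)"

definition H1 :: "(real \<Rightarrow> complex) set" where
  "H1 = {f \<in> L2. \<exists>g \<in> L2. has_weak_deriv f g}"

type_synonym triple = "(real \<Rightarrow> complex) \<times> (real \<Rightarrow> complex) \<times> (real \<Rightarrow> complex)"

definition scalar_energy :: "real \<Rightarrow> (real \<Rightarrow> complex) \<Rightarrow> real" where
  "scalar_energy \<beta> u =
     1 / 2 * (LINT x|lebesgue. (cmod (weak_deriv u x))\<^sup>2)
     - \<beta> / 3 * (LINT x|lebesgue. (cmod (u x)) ^ 3)"

fun energy :: "real \<Rightarrow> real \<Rightarrow> triple \<Rightarrow> real" where
  "energy \<alpha> \<beta> (u1, u2, u3) =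
     scalar_energy \<beta> u1 + scalar_energy \<beta> u2 + scalar_energy \<beta> u3
     - \<alpha> * Re (LINT x|lebesgue. u1 x * u2 x * cnj (u3 x))"

definition admissible :: "real \<Rightarrow> real \<Rightarrow> real \<Rightarrow> triple set" where
  "admissible \<gamma> \<mu> s =
     {(u1, u2, u3) \<in> H1 \<times> H1 \<times> H1.
        (L2_norm u1)\<^sup>2 = \<gamma> \<and> (L2_norm u2)\<^sup>2 = \<mu> \<and> (L2_norm u3)\<^sup>2 = s}"

text \<open>The infimum is taken in the extended reals, since \<open>Inf\<close> on the reals is unspecified for sets
  that are empty or unbounded below.\<close>

definition min_energy :: "real \<Rightarrow> real \<Rightarrow> real \<Rightarrow> real \<Rightarrow> real \<Rightarrow> ereal" where
  "min_energy \<alpha> \<beta> \<gamma> \<mu> s = (INF u \<in> admissible \<gamma> \<mu> s. ereal (energy \<alpha> \<beta> u))"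

definition minimizers :: "real \<Rightarrow> real \<Rightarrow> real \<Rightarrow> real \<Rightarrow> real \<Rightarrow> triple set" where
  "minimizers \<alpha> \<beta> \<gamma> \<mu> s =
     {u \<in> admissible \<gamma> \<mu> s. ereal (energy \<alpha> \<beta> u) = min_energy \<alpha> \<beta> \<gamma> \<mu> s}"

definition soliton_mass :: "real \<Rightarrow> real \<Rightarrow> real \<Rightarrow> real" where
  "soliton_mass \<alpha> \<beta> \<omega> = 12 * sqrt 2 * \<omega> powr (3 / 2) / (\<alpha> + \<beta>)\<^sup>2"

definition sech :: "real \<Rightarrow> real" where
  "sech x = 1 / cosh x"

definition soliton :: "real \<Rightarrow> real \<Rightarrow> real \<Rightarrow> real \<Rightarrow> real" where
  "soliton \<alpha> \<beta> \<omega> x = 3 * \<omega> / (\<alpha> + \<beta>) * (sech (1 / 2 * sqrt (2 * \<omega>) * x))\<^sup>2"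

end

theory Submission
  imports Defs "HOL-Computational_Algebra.Polynomial"
begin

text \<open>By the inequality of arithmetic and geometric means
  \<open>Re (u\<^sub>1 u\<^sub>2 cnj u\<^sub>3) \<le> (\<bar>u\<^sub>1\<bar>\<^sup>3 + \<bar>u\<^sub>2\<bar>\<^sup>3 + \<bar>u\<^sub>3\<bar>\<^sup>3) / 3\<close>, the energy is at least the sum of three scalar
  energies with coupling \<open>\<alpha> + \<beta>\<close>, and equality ties the moduli and phases together. It
  remains to show that the soliton is, up to phase and translation, the only minimizer of the scalar energy.

  Put \<open>d = 2 (\<alpha> + \<beta>) / 3\<close>, let \<open>M\<close> be the maximum of \<open>\<bar>u\<bar>\<close>, and let \<open>G s = s sqrt (d (M - s))\<close> with antiderivative
  \<open>H\<close>, \<open>H 0 = 0\<close>. Since \<open>\<bar>u\<bar>\<close> climbs from \<open>0\<close> to \<open>M\<close> and descends again, \<open>\<integral> \<bar>u'\<bar> G(\<bar>u\<bar>) \<ge> 2 H M\<close>, and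
  \<open>G\<^sup>2\<close> is a combination of \<open>s\<^sup>2\<close> and \<open>s\<^sup>3\<close>. Completing the square, the scalar energy is at least
  \<open>\<integral> (\<bar>u'\<bar> - G(\<bar>u\<bar>))\<^sup>2 / 2 + f(M)\<close>, where for the prescribed mass \<open>f\<close> has a unique minimum at the height of the
  soliton. In the case of equality \<open>\<bar>u'\<bar> = G(\<bar>u\<bar>)\<close>, which forces \<open>\<bar>u\<bar>\<close> to stay above the soliton centred at a
  maximum point; equal masses give equality, and then \<open>\<bar>u'\<bar> = \<bar>\<bar>u\<bar>'\<bar>\<close> makes the phase constant.\<close>

section \<open>Smooth functions with compact support\<close>

text \<open>The sharp lower bound also settles existence: it is attained by the soliton triples, so
  no compactness of minimizing sequences, no rearrangement and no Euler-Lagrange equation enters.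
  The speed \<open>G\<close> must be real at every value of |u|; hence it is built from the maximum
  \<open>M\<close> of the given function and not from the height of the soliton. Each
  \<open>M\<close> trades the cubic term for a multiple of the prescribed mass, and what remains is
  a problem in one variable, a quintic in sqrt M. The obstacle is regularity. A modulus |u| is known
  only through increments bounded by integrals of |u'|, so the product rule and an integrated chain
  rule are derived from such increments by bisection of intervals, and the comparison with the
  soliton uses nothing more. Weak derivatives are linked to primitives by testing, which requires a
  concrete supply of test functions; they are built from exp (- 1 / x).\<close>

definition flat :: "real poly \<Rightarrow> real \<Rightarrow> real" where
  "flat p x = (if x > 0 then poly p (1 / x) * exp (- (1 / x)) else 0)"

lemma poly_over_exp_tendsto_0: "((\<lambda>y::real. poly p y * exp (- y)) \<longlongrightarrow> 0) at_top"
proof -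
  have "((\<lambda>y::real. \<Sum>i\<le>degree p. coeff p i * (y ^ i / exp y)) \<longlongrightarrow> (\<Sum>i\<le>degree p. coeff p i * 0)) at_top"
    by (intro tendsto_sum tendsto_mult tendsto_const tendsto_power_div_exp_0)
  then show ?thesis
    by (simp add: poly_altdef sum_distrib_right exp_minus divide_inverse mult.assoc)
qed

lemma flat_tendsto_0: "(flat p \<longlongrightarrow> 0) (at 0)"
proof (rule filterlim_split_at)
  show "(flat p \<longlongrightarrow> 0) (at_left 0)"
    by (rule tendsto_eventually) (auto simp: flat_def eventually_at_filter)
  have "((\<lambda>x. poly p (inverse x) * exp (- inverse x)) \<longlongrightarrow> 0) (at_right 0)"
    by (rule filterlim_compose[OF poly_over_exp_tendsto_0 filterlim_inverse_at_top_right])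
  then show "(flat p \<longlongrightarrow> 0) (at_right 0)"
    by (rule Lim_transform_eventually)
       (auto simp: flat_def eventually_at_filter inverse_eq_divide)
qed

text \<open>With y = 1 / x, differentiating p(y) exp (- y) in x gives y^2 (p(y) - p'(y)) exp (- y),
  and each \<open>pCons 0\<close> is a factor y. The polynomial factor in \<open>flat\<close> is
  there to keep the family closed under differentiation.\<close>

lemma flat_has_derivative:
  "(flat p has_real_derivative flat (pCons 0 (pCons 0 (p - pderiv p))) x) (at x)"
proof -
  consider "x > 0" | "x < 0" | "x = 0" by linarith
  then show ?thesis
  proof cases
    case 1
    have "((\<lambda>x. poly p (1 / x) * exp (- (1 / x))) has_real_derivative
        flat (pCons 0 (pCons 0 (p - pderiv p))) x) (at x)"
      using 1 by (auto intro!: derivative_eq_intros simp: flat_def field_simps power2_eq_square)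
    then show ?thesis
      by (rule has_field_derivative_transform_within_open[of _ _ _ "{0<..}"])
         (use 1 in \<open>auto simp: flat_def\<close>)
  next
    case 2
    have "((\<lambda>x. 0) has_real_derivative flat (pCons 0 (pCons 0 (p - pderiv p))) x) (at x)"
      using 2 by (auto simp: flat_def)
    then show ?thesis
      by (rule has_field_derivative_transform_within_open[of _ _ _ "{..<0}"])
         (use 2 in \<open>auto simp: flat_def\<close>)
  next
    case 3
    \<comment> \<open>Division by h is one more factor 1 / h, so away from 0 the difference quotient
      at 0 is itself \<open>flat (pCons 0 p)\<close>.\<close>
    have "((\<lambda>h. (flat p (0 + h) - flat p 0) / h) \<longlongrightarrow> 0) (at 0)"
      by (rule Lim_transform_eventually[OF flat_tendsto_0[of "pCons 0 p"]])
         (auto simp: flat_def eventually_at_filter)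
    then show ?thesis
      unfolding 3 DERIV_def by (simp add: flat_def)
  qed
qed

text \<open>Closed under differentiation, so that all members are smooth.\<close>

inductive flat_algebra :: "(real \<Rightarrow> real) \<Rightarrow> bool" where
  const: "flat_algebra (\<lambda>x. c)"
| flat: "flat_algebra (\<lambda>x. flat p (c * x + d))"
| add: "flat_algebra f \<Longrightarrow> flat_algebra g \<Longrightarrow> flat_algebra (\<lambda>x. f x + g x)"
| mult: "flat_algebra f \<Longrightarrow> flat_algebra g \<Longrightarrow> flat_algebra (\<lambda>x. f x * g x)"

lemma flat_algebra_derivative:
  assumes "flat_algebra f"
  shows "\<exists>f'. flat_algebra f' \<and> (\<forall>x. (f has_real_derivative f' x) (at x))"
  using assms
proof induction
  case (const c)
  then show ?case by (intro exI[of _ "\<lambda>x. 0"]) (auto intro: flat_algebra.const)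
next
  case (flat p c d)
  let ?q = "pCons 0 (pCons 0 (p - pderiv p))"
  have "flat_algebra (\<lambda>x. c * flat ?q (c * x + d))"
    by (intro flat_algebra.intros)
  moreover have "((\<lambda>x. flat p (c * x + d)) has_real_derivative c * flat ?q (c * x + d)) (at x)" for x
    by (rule DERIV_cong[OF DERIV_chain2[OF flat_has_derivative]])
       (auto intro!: derivative_eq_intros simp del: mult_pCons_left)
  ultimately show ?case by blast
next
  case (add f g)
  then obtain f' g' where "flat_algebra f'" "\<forall>x. (f has_real_derivative f' x) (at x)"
    "flat_algebra g'" "\<forall>x. (g has_real_derivative g' x) (at x)" by blast
  then show ?case
    by (intro exI[of _ "\<lambda>x. f' x + g' x"]) (auto intro!: flat_algebra.intros derivative_intros)
next
  case (mult f g)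
  then obtain f' g' where *: "flat_algebra f'" "\<forall>x. (f has_real_derivative f' x) (at x)"
    "flat_algebra g'" "\<forall>x. (g has_real_derivative g' x) (at x)" by blast
  then have "flat_algebra (\<lambda>x. f' x * g x + g' x * f x)"
    using mult by (intro flat_algebra.intros)
  with * show ?case
    by (intro exI[of _ "\<lambda>x. f' x * g x + g' x * f x"]) (auto intro!: derivative_eq_intros)
qed

lemma flat_algebra_higher_deriv: "flat_algebra f \<Longrightarrow> flat_algebra ((deriv ^^ n) f)"
proof (induction n)
  case (Suc n)
  then obtain f' where "flat_algebra f'" "\<forall>x. ((deriv ^^ n) f has_real_derivative f' x) (at x)"
    using flat_algebra_derivative by blast
  moreover from this have "deriv ((deriv ^^ n) f) = f'"
    by (auto intro!: ext DERIV_imp_deriv)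
  ultimately show ?case by simp
qed auto

lemma flat_algebra_differentiable:
  assumes "flat_algebra f"
  shows "(deriv ^^ n) f field_differentiable at x"
  using flat_algebra_derivative[OF flat_algebra_higher_deriv[OF assms]]
  by (auto simp: field_differentiable_def)

lemma flat_algebra_continuous: "flat_algebra f \<Longrightarrow> continuous_on S f"
  using flat_algebra_derivative by (meson DERIV_isCont continuous_at_imp_continuous_on)

lemma compact_support_Icc:
  fixes f :: "real \<Rightarrow> 'a::zero"
  assumes "\<And>x. x \<notin> {a..b} \<Longrightarrow> f x = 0"
  shows "compact (closure {x. f x \<noteq> 0})"
proof -
  have "bounded {x. f x \<noteq> 0}"
    by (rule bounded_subset[OF bounded_closed_interval[of a b]]) (use assms in force)
  then show ?thesis by simp
qed

lemma test_function_flat_algebra: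
  assumes "flat_algebra f" "\<And>x. x \<notin> {a..b} \<Longrightarrow> f x = 0"
  shows "test_function f"
  using assms flat_algebra_differentiable compact_support_Icc
  unfolding test_function_def by blast

lemma test_functionE:
  assumes "test_function \<phi>"
  obtains a b where "a \<le> b" "\<And>x. x \<notin> {a..b} \<Longrightarrow> \<phi> x = 0" "\<And>x. x \<notin> {a..b} \<Longrightarrow> deriv \<phi> x = 0"
    "\<And>x. (\<phi> has_real_derivative deriv \<phi> x) (at x)" "\<And>S. continuous_on S (deriv \<phi>)"
proof -
  have "bounded (closure {x. \<phi> x \<noteq> 0})"
    using assms compact_imp_bounded unfolding test_function_def by blast
  then have "bounded {x. \<phi> x \<noteq> 0}"
    using bounded_subset closure_subset by blast
  then obtain B where B: "\<And>x. \<phi> x \<noteq> 0 \<Longrightarrow> \<bar>x\<bar> \<le> B"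
    unfolding bounded_iff by auto
  have D: "(\<phi> has_real_derivative deriv \<phi> x) (at x)" for x
    using assms unfolding test_function_def
    by (metis DERIV_deriv_iff_field_differentiable funpow_0)
  have "(deriv ^^ Suc 0) \<phi> field_differentiable at x" for x
    using assms unfolding test_function_def by blast
  then have C: "continuous_on S (deriv \<phi>)" for S
    by (auto intro!: continuous_at_imp_continuous_on field_differentiable_imp_continuous_at)
  have Z: "deriv \<phi> x = 0" if "x \<notin> {-\<bar>B\<bar>..\<bar>B\<bar>}" for x
  proof -
    have "((\<lambda>x. 0) has_real_derivative 0) (at x)" by simp
    then have "(\<phi> has_real_derivative 0) (at x)"
      by (rule has_field_derivative_transform_within_open[of _ _ _ "- {-\<bar>B\<bar>..\<bar>B\<bar>}"])
         (use that B in \<open>force simp: open_Compl\<close>)+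
    then show ?thesis by (rule DERIV_imp_deriv)
  qed
  show ?thesis
    by (rule that[of "-\<bar>B\<bar>" "\<bar>B\<bar>"]) (use B C D Z in force)+
qed

section \<open>Bumps approximating indicators of intervals\<close>

text \<open>Scaling the argument by \<open>n\<close> makes each factor tend to 1 where it is
  positive, so the bumps converge boundedly to the indicator of the open interval while keeping
  their support.\<close>

definition bump :: "real \<Rightarrow> real \<Rightarrow> nat \<Rightarrow> real \<Rightarrow> real" where
  "bump a b n x = flat 1 (real n * (x - a)) * flat 1 (real n * (b - x))"

lemma flat_algebra_bump: "flat_algebra (bump a b n)"
proof -
  have "flat_algebra (\<lambda>x. flat 1 (real n * x + - (real n * a)) * flat 1 (- real n * x + real n * b))"
    by (intro flat_algebra.intros)
  moreover have "real n * x + - (real n * a) = real n * (x - a)"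
      "- real n * x + real n * b = real n * (b - x)" for x
    by (auto simp: algebra_simps)
  ultimately have "flat_algebra (\<lambda>x. flat 1 (real n * (x - a)) * flat 1 (real n * (b - x)))"
    by simp
  then show ?thesis by (simp add: bump_def[abs_def])
qed

lemma flat_one_bounds: "0 \<le> flat 1 x" "flat 1 x \<le> 1"
  by (auto simp: flat_def)

lemma bump_bounds: "0 \<le> bump a b n x" "bump a b n x \<le> 1"
  by (auto simp: bump_def flat_one_bounds mult_le_one)

lemma bump_outside: "x \<notin> {a<..<b} \<Longrightarrow> bump a b n x = 0"
  by (auto simp: bump_def flat_def zero_less_mult_iff)

lemma bump_pos: "a < x \<Longrightarrow> x < b \<Longrightarrow> bump a b 1 x > 0"
  by (auto simp: bump_def flat_def)

lemma flat_scaled_tendsto: "x > 0 \<Longrightarrow> (\<lambda>n. flat 1 (real n * x)) \<longlonglongrightarrow> 1"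
proof -
  assume x: "x > 0"
  have "(\<lambda>n. exp (- (1 / (real n * x)))) \<longlonglongrightarrow> exp (- 0)"
    by (intro tendsto_intros real_tendsto_divide_at_top[OF tendsto_const]
        filterlim_at_top_mult_tendsto_pos[OF tendsto_const x filterlim_real_sequentially,
          unfolded mult.commute[of _ x], unfolded mult.commute[of x]])
  then have "(\<lambda>n. exp (- (1 / (real n * x)))) \<longlonglongrightarrow> 1" by simp
  then show ?thesis
    by (rule Lim_transform_eventually)
       (use x in \<open>auto simp: flat_def eventually_sequentially intro!: exI[of _ 1]\<close>)
qed

lemma bump_tendsto: "(\<lambda>n. bump a b n x) \<longlonglongrightarrow> indicator {a<..<b} x"
proof (cases "x \<in> {a<..<b}")
  case True
  then have "(\<lambda>n. bump a b n x) \<longlonglongrightarrow> 1 * 1"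
    unfolding bump_def by (intro tendsto_mult flat_scaled_tendsto) auto
  with True show ?thesis by simp
qed (simp add: bump_outside)

section \<open>The fundamental lemma of the calculus of variations\<close>

lemma absolutely_integrable_continuous_mult:
  fixes f g :: "real \<Rightarrow> 'a::{euclidean_space, real_normed_algebra}"
  assumes "continuous_on {a..b} f" "g absolutely_integrable_on {a..b}"
  shows "(\<lambda>x. f x * g x) absolutely_integrable_on {a..b}"
  by (rule absolutely_integrable_bounded_measurable_product)
     (auto simp: assms bilinear_times intro!: continuous_imp_measurable_on_sets_lebesgue
        compact_imp_bounded compact_continuous_image assms(1))

lemma locally_integrable_Icc: "locally_integrable f \<Longrightarrow> f absolutely_integrable_on {a..b}"
  by (simp add: locally_integrable_def)

lemma locally_integrable_integrable_on: "locally_integrable f \<Longrightarrow> f integrable_on {a..b}"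
  by (simp add: locally_integrable_def absolutely_integrable_on_def)

lemma locally_integrable_norm_integrable_on:
  "locally_integrable f \<Longrightarrow> (\<lambda>x. cmod (f x)) integrable_on {a..b}"
  by (simp add: locally_integrable_def absolutely_integrable_on_def)

lemma locally_integrable_continuous: "continuous_on UNIV f \<Longrightarrow> locally_integrable f"
  unfolding locally_integrable_def
  by (auto intro: absolutely_integrable_continuous_real continuous_on_subset)

lemma locally_integrable_mult_continuous:
  assumes "locally_integrable f" "continuous_on UNIV h"
  shows "locally_integrable (\<lambda>x. f x * h x)"
  using absolutely_integrable_continuous_mult[of _ _ h f] assms
  unfolding locally_integrable_def by (auto simp: mult.commute intro: continuous_on_subset)

lemma locally_integrable_add:
  "locally_integrable f \<Longrightarrow> locally_integrable g \<Longrightarrow> locally_integrable (\<lambda>x. f x + g x)"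
  by (simp add: locally_integrable_def)

lemma locally_integrable_diff:
  "locally_integrable f \<Longrightarrow> locally_integrable g \<Longrightarrow> locally_integrable (\<lambda>x. f x - g x)"
  by (simp add: locally_integrable_def)

lemma
  fixes f :: "real \<Rightarrow> 'a::euclidean_space"
  assumes f: "f absolutely_integrable_on {a..b}" and out: "\<And>x. x \<notin> {a..b} \<Longrightarrow> f x = 0"
  shows integrable_vanishing_outside: "integrable lebesgue f"
    and integral_vanishing_outside: "(LINT x|lebesgue. f x) = integral {a..b} f"
proof -
  have "indicator {a..b} x *\<^sub>R f x = f x" for x
    using out by (auto simp: indicator_def)
  with f show "integrable lebesgue f" "(LINT x|lebesgue. f x) = integral {a..b} f"
    using set_lebesgue_integral_eq_integral(2)[OF f]
    by (auto simp: set_integrable_def set_lebesgue_integral_def)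
qed

text \<open>Henstock's lemma bounds the sum of the norms of the local errors of a fine division.
  When all interval integrals vanish, these errors are the terms of the Riemann sum of the
  norm.\<close>

lemma norm_has_integral_0_if_intervals_0:
  fixes g :: "real \<Rightarrow> 'a::euclidean_space"
  assumes g: "g integrable_on {a..b}"
    and zero: "\<And>c d. a \<le> c \<Longrightarrow> c \<le> d \<Longrightarrow> d \<le> b \<Longrightarrow> integral {c..d} g = 0"
  shows "((\<lambda>x. norm (g x)) has_integral 0) {a..b}"
proof -
  have "\<exists>\<gamma>. gauge \<gamma> \<and> (\<forall>p. p tagged_division_of cbox a b \<and> \<gamma> fine p \<longrightarrow>
      norm ((\<Sum>(x, k)\<in>p. measure lborel k *\<^sub>R norm (g x)) - 0) < e)" if "e > 0" for e
  proof -
    from g that obtain \<gamma> where \<gamma>: "gauge \<gamma>"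
      and fine: "\<And>p. \<lbrakk>p tagged_partial_division_of (cbox a b); \<gamma> fine p\<rbrakk> \<Longrightarrow>
             (\<Sum>(x, k)\<in>p. norm (measure lborel k *\<^sub>R g x - integral k g)) < e"
      using Henstock_lemma[of g a b e] by (auto simp: cbox_interval)
    have small: "norm ((\<Sum>(x, k)\<in>p. measure lborel k *\<^sub>R norm (g x)) - 0) < e"
      if p: "p tagged_division_of cbox a b" "\<gamma> fine p" for p
    proof -
      have "integral k g = 0" if "(x, k) \<in> p" for x k
      proof -
        have "\<exists>c d. k = cbox c d" using tagged_division_ofD(4)[OF p(1) that] .
        then obtain c d where k: "k = cbox c d" by blast
        moreover have "x \<in> k" "k \<subseteq> cbox a b"
          using tagged_division_ofD(2,3)[OF p(1) that] by auto
        ultimately show ?thesis using zero[of c d] by auto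
      qed
      then have eq: "(\<Sum>(x, k)\<in>p. measure lborel k *\<^sub>R norm (g x)) =
          (\<Sum>(x, k)\<in>p. norm (measure lborel k *\<^sub>R g x - integral k g))"
        by (intro sum.cong) auto
      have part: "p tagged_partial_division_of cbox a b"
        using p(1) by (simp only: tagged_division_of_def)
      have "0 \<le> (\<Sum>(x, k)\<in>p. norm (measure lborel k *\<^sub>R g x - integral k g))"
        by (intro sum_nonneg) (simp add: split_beta)
      then show ?thesis
        unfolding eq diff_zero real_norm_def using fine[OF part p(2)] by linarith
    qed
    show ?thesis
      by (intro exI[of _ \<gamma>] conjI allI impI \<gamma>, elim conjE, rule small)
  qed
  then have "((\<lambda>x. norm (g x)) has_integral 0) (cbox a b)"
    unfolding has_integral by blast
  then show ?thesis by (simp add: cbox_interval)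
qed

lemma AE_eq_0_if_intervals_0:
  assumes g: "locally_integrable g" and zero: "\<And>a b. a \<le> b \<Longrightarrow> integral {a..b} g = 0"
  shows "AE x in lebesgue. g x = 0"
proof -
  have "AE x in lebesgue. indicator {-real n..real n} x *\<^sub>R cmod (g x) = 0" for n
  proof -
    have "((\<lambda>x. cmod (g x)) has_integral 0) {-real n..real n}"
      by (intro norm_has_integral_0_if_intervals_0 zero locally_integrable_integrable_on[OF g])
    moreover have ai: "(\<lambda>x. cmod (g x)) absolutely_integrable_on {-real n..real n}"
      using locally_integrable_Icc[OF g] by (rule set_integrable_norm)
    ultimately have "(LINT x:{-real n..real n}|lebesgue. cmod (g x)) = 0"
      by (metis has_integral_set_lebesgue has_integral_unique)
    then show ?thesis
      using ai by (subst (asm) set_lebesgue_integral_def, subst (asm) integral_nonneg_eq_0_iff_AE)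
        (auto simp: set_integrable_def)
  qed
  then have "AE x in lebesgue. \<forall>n. indicator {-real n..real n} x *\<^sub>R cmod (g x) = 0"
    by (subst AE_all_countable) simp
  then show ?thesis
  proof (rule AE_mp, intro AE_I2 impI)
    fix x assume *: "\<forall>n. indicator {-real n..real n} x *\<^sub>R cmod (g x) = 0"
    obtain n where "\<bar>x\<bar> \<le> real n" using real_arch_simple by blast
    with *[rule_format, of n] show "g x = 0" by (auto simp: indicator_def split: if_splits)
  qed
qed

lemma continuous_on_bump: "continuous_on S (bump a b n)"
  by (rule flat_algebra_continuous[OF flat_algebra_bump])

lemma integrable_mult_bump:
  assumes "locally_integrable g"
  shows "(\<lambda>x. g x * complex_of_real (bump a b n x)) absolutely_integrable_on {c..d}"
    and "integrable lebesgue (\<lambda>x. g x * complex_of_real (bump a b n x))"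
proof -
  have "locally_integrable (\<lambda>x. g x * complex_of_real (bump a b n x))"
    by (intro locally_integrable_mult_continuous assms continuous_intros continuous_on_bump)
  then show 1: "(\<lambda>x. g x * complex_of_real (bump a b n x)) absolutely_integrable_on {c..d}" for c d
    by (rule locally_integrable_Icc)
  show "integrable lebesgue (\<lambda>x. g x * complex_of_real (bump a b n x))"
    by (rule integrable_vanishing_outside[OF 1[of a b]]) (auto simp: bump_outside)
qed

text \<open>Dominated convergence turns bumps into indicators, so all interval integrals of
  \<open>g\<close> vanish. Asking for bumps only keeps the hypothesis checkable in
  \<open>du_Bois_Reymond\<close>, where a bump has to be corrected before it can be used.\<close>

lemma fundamental_lemma:
  assumes g: "locally_integrable g"
    and zero: "\<And>a b n. a < b \<Longrightarrow> (LINT x|lebesgue. g x * complex_of_real (bump a b n x)) = 0"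
  shows "AE x in lebesgue. g x = 0"
proof (rule AE_eq_0_if_intervals_0[OF g])
  fix a b :: real assume "a \<le> b"
  show "integral {a..b} g = 0"
  proof (cases "a = b")
    case False
    with \<open>a \<le> b\<close> have ab: "a < b" by simp
    have lim: "(\<lambda>n. integral {a..b} (\<lambda>x. g x * complex_of_real (bump a b n x)))
        \<longlonglongrightarrow> integral {a..b} (\<lambda>x. g x * complex_of_real (indicator {a<..<b} x))"
    proof (rule dominated_convergence(2))
      show "(\<lambda>x. g x * complex_of_real (bump a b n x)) integrable_on {a..b}" for n
        using integrable_mult_bump(1)[OF g] absolutely_integrable_on_def by blast
      show "(\<lambda>x. cmod (g x)) integrable_on {a..b}"
        using g by (rule locally_integrable_norm_integrable_on)
      show "norm (g x * complex_of_real (bump a b n x)) \<le> cmod (g x)" for n x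
        using bump_bounds[of a b n x] by (simp add: norm_mult mult_left_le)
      show "(\<lambda>n. g x * complex_of_real (bump a b n x))
          \<longlonglongrightarrow> g x * complex_of_real (indicator {a<..<b} x)" for x
        by (intro tendsto_intros bump_tendsto)
    qed
    have "integral {a..b} (\<lambda>x. g x * complex_of_real (bump a b n x)) = 0" for n
      using zero[OF ab, of n] integrable_mult_bump(1)[OF g]
      by (subst integral_vanishing_outside[symmetric]) (auto simp: bump_outside)
    with lim have "integral {a..b} (\<lambda>x. g x * complex_of_real (indicator {a<..<b} x)) = 0"
      by (simp add: LIMSEQ_const_iff)
    moreover have "integral {a..b} g = integral {a..b} (\<lambda>x. g x * complex_of_real (indicator {a<..<b} x))"
      by (rule integral_spike[of "{a, b}"]) auto
    ultimately show ?thesis by simp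
  qed auto
qed

lemma antiderivative_continuous_UNIV:
  assumes "continuous_on UNIV (f :: real \<Rightarrow> real)"
  obtains F where "\<And>x. (F has_real_derivative f x) (at x)"
proof -
  have "\<exists>F. \<forall>x. - \<infinity> < ereal x \<longrightarrow> ereal x < \<infinity> \<longrightarrow> (F has_vector_derivative f x) (at x)"
    by (rule einterval_antiderivative) (use assms in \<open>auto simp: continuous_on_eq_continuous_at\<close>)
  then show ?thesis
    using that by (auto simp: has_real_derivative_iff_has_vector_derivative)
qed

text \<open>The primitive that vanishes at \<open>a\<close> stays 0 to the left; that it returns to
  0 at \<open>b\<close> is exactly the vanishing of the integral.\<close>

lemma test_function_antiderivative:
  assumes \<rho>: "flat_algebra \<rho>" and out: "\<And>x. x \<notin> {a<..<b} \<Longrightarrow> \<rho> x = 0"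
    and int: "integral {a..b} \<rho> = 0" and ab: "a \<le> b"
  obtains \<eta> where "test_function \<eta>" "deriv \<eta> = \<rho>"
proof -
  obtain F where F: "\<And>x. (F has_real_derivative \<rho> x) (at x)"
    using antiderivative_continuous_UNIV[OF flat_algebra_continuous[OF \<rho>]] by blast
  define \<eta> where "\<eta> x = F x - F a" for x
  have D: "(\<eta> has_real_derivative \<rho> x) (at x)" for x
    unfolding \<eta>_def by (auto intro!: derivative_eq_intros F)
  then have deriv: "deriv \<eta> = \<rho>" by (auto intro!: ext DERIV_imp_deriv)
  have FTC: "(\<rho> has_integral F y - F x) {x..y}" if "x \<le> y" for x y
    using that F by (intro fundamental_theorem_of_calculus)
      (auto intro: has_field_derivative_at_within
        simp: has_real_derivative_iff_has_vector_derivative[symmetric])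
  have null: "(\<rho> has_integral 0) {x..y}" if "y \<le> a \<or> b \<le> x" for x y
    using that out by (intro has_integral_is_0) auto
  have "\<eta> x = 0" if x: "x \<notin> {a..b}" for x
  proof (cases "x < a")
    case True
    then have "F a - F x = 0" using has_integral_unique[OF FTC[of x a] null[where x=x and y=a]] by simp
    then show ?thesis by (simp add: \<eta>_def)
  next
    case False
    with x have "b < x" by auto
    then have "F x - F b = 0" using has_integral_unique[OF FTC[of b x] null[where x=b and y=x]] by simp
    moreover have "F b - F a = 0" using integral_unique[OF FTC[OF ab]] int by simp
    ultimately show ?thesis by (simp add: \<eta>_def)
  qed
  then have "compact (closure {x. \<eta> x \<noteq> 0})" by (rule compact_support_Icc)
  moreover have "(deriv ^^ n) \<eta> field_differentiable at x" for n x
  proof (cases n)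
    case 0
    with D show ?thesis by (auto simp: field_differentiable_def)
  next
    case (Suc m)
    then show ?thesis
      using flat_algebra_differentiable[OF \<rho>] by (simp add: funpow_Suc_right deriv del: funpow.simps)
  qed
  ultimately have "test_function \<eta>" by (simp add: test_function_def)
  with deriv that show ?thesis by blast
qed

lemma bump_integrable_on: "bump a b n integrable_on {c..d}"
  by (intro integrable_continuous_real continuous_on_bump)

lemma integral_bump_pos: "integral {0..1} (bump 0 1 1) > 0"
proof -
  have "integral {0..1} (bump 0 1 1) \<noteq> 0"
  proof
    assume "integral {0..1} (bump 0 1 1) = 0"
    then have "bump 0 1 1 (1/2) = 0"
      using integral_eq_0_iff[of 0 1 "bump 0 1 1"] continuous_on_bump bump_bounds by auto
    then show False using bump_pos[of 0 "1/2" 1] by simp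
  qed
  moreover have "integral {0..1} (bump 0 1 1) \<ge> 0"
    by (intro integral_nonneg bump_integrable_on bump_bounds)
  ultimately show ?thesis by simp
qed

text \<open>Subtracting the right multiple of one fixed bump from a given bump makes its integral
  zero, hence makes it the derivative of a test function. The hypothesis then says that
  \<open>w\<close> and a constant agree when tested against bumps.\<close>

lemma du_Bois_Reymond:
  assumes w: "locally_integrable w"
    and zero: "\<And>\<phi>. test_function \<phi> \<Longrightarrow> (LINT x|lebesgue. w x * complex_of_real (deriv \<phi> x)) = 0"
  obtains c where "AE x in lebesgue. w x = c"
proof -
  define J where "J = integral {0..1} (bump 0 1 1)"
  \<comment> \<open>The only possible constant: the mean of \<open>w\<close> weighted by the fixed
    bump.\<close>
  define c where "c = (LINT x|lebesgue. w x * complex_of_real (bump 0 1 1 x)) / complex_of_real J"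
  have J: "J > 0" unfolding J_def by (rule integral_bump_pos)
  have "AE x in lebesgue. w x - c = 0"
  proof (rule fundamental_lemma)
    show "locally_integrable (\<lambda>x. w x - c)"
      by (intro locally_integrable_diff w locally_integrable_continuous continuous_intros)
    fix a b :: real and n assume ab: "a < b"
    define r where "r = integral {a..b} (bump a b n) / J"
    define \<rho> where "\<rho> x = bump a b n x + (- r) * bump 0 1 1 x" for x
    let ?l = "min a 0" and ?u = "max b 1"
    have "flat_algebra \<rho>"
      unfolding \<rho>_def[abs_def] by (intro flat_algebra.intros flat_algebra_bump)
    moreover have "\<rho> x = 0" if "x \<notin> {?l<..<?u}" for x
      using that bump_outside[of x a b n] bump_outside[of x 0 1 1] by (force simp: \<rho>_def)
    moreover have "integral {?l..?u} \<rho> = 0"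
    proof -
      have ext: "integral {?l..?u} (bump c d m) = integral {c..d} (bump c d m)"
        if "{c..d} \<subseteq> {?l..?u}" for c d m
        by (rule integral_unique, rule has_integral_on_superset[OF integrable_integral[OF bump_integrable_on]])
           (use that in \<open>auto intro!: bump_outside\<close>)
      have "integral {?l..?u} \<rho> = integral {?l..?u} (bump a b n) + (- r) * integral {?l..?u} (bump 0 1 1)"
        unfolding \<rho>_def
        by (subst integral_add) (auto intro!: integrable_continuous_real continuous_intros continuous_on_bump)
      then show ?thesis using integral_bump_pos by (simp add: ext r_def J_def)
    qed
    ultimately obtain \<eta> where \<eta>: "test_function \<eta>" "deriv \<eta> = \<rho>"
      by (rule test_function_antiderivative) auto
    note int = integrable_mult_bump(2)[OF w]
    have "0 = (LINT x|lebesgue. w x * complex_of_real (\<rho> x))"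
      using zero[OF \<eta>(1)] \<eta>(2) by simp
    also have "\<dots> = (LINT x|lebesgue. w x * complex_of_real (bump a b n x)
        - complex_of_real r * (w x * complex_of_real (bump 0 1 1 x)))"
      by (rule Bochner_Integration.integral_cong) (auto simp: \<rho>_def algebra_simps)
    also have "\<dots> = (LINT x|lebesgue. w x * complex_of_real (bump a b n x)) - complex_of_real r * (complex_of_real J * c)"
      using int J by (subst Bochner_Integration.integral_diff) (auto simp: c_def)
    finally have 1: "(LINT x|lebesgue. w x * complex_of_real (bump a b n x)) = c * complex_of_real (r * J)"
      by simp
    have "locally_integrable (\<lambda>x. 1)" by (intro locally_integrable_continuous continuous_intros)
    note int1 = integrable_mult_bump[OF this]
    have "(LINT x|lebesgue. complex_of_real (bump a b n x)) = integral {a..b} (\<lambda>x. complex_of_real (bump a b n x))"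
      using int1(1)[where a=a and b=b and n=n and c=a and d=b] by (intro integral_vanishing_outside) (auto simp: bump_outside)
    also have "\<dots> = complex_of_real (r * J)"
      using J integral_linear[OF bump_integrable_on[of a b n a b] bounded_linear_of_real]
      by (auto simp: r_def o_def)
    finally have 2: "(LINT x|lebesgue. complex_of_real (bump a b n x)) = complex_of_real (r * J)" .
    have "(LINT x|lebesgue. (w x - c) * complex_of_real (bump a b n x)) =
        (LINT x|lebesgue. w x * complex_of_real (bump a b n x)) - c * (LINT x|lebesgue. complex_of_real (bump a b n x))"
      using int int1(2)[where a=a and b=b and n=n]
      by (subst Bochner_Integration.integral_mult_right_zero[symmetric],
          subst Bochner_Integration.integral_diff[symmetric]) (auto simp: algebra_simps)
    also have "\<dots> = 0" using 1 2 by simp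
    finally show "(LINT x|lebesgue. (w x - c) * complex_of_real (bump a b n x)) = 0" .
  qed
  then show ?thesis using that[of c] by simp
qed

section \<open>Weak derivatives and primitives\<close>

text \<open>Turns local estimates into global ones. The bound \<open>F x y \<le> e * K x y\<close>
  survives joining adjacent intervals, so by bisection it suffices to have it on short intervals
  around each point; then \<open>e\<close> tends to 0. In the applications \<open>F\<close> measures
  the defect of an identity or inequality and \<open>K\<close> integrates a nonnegative function, so
  no pointwise derivative is needed.\<close>

lemma subadditive_interval_nonpos:
  fixes F K :: "real \<Rightarrow> real \<Rightarrow> real"
  assumes ab: "a \<le> b"
    and F: "\<And>x y z. a \<le> x \<Longrightarrow> x \<le> y \<Longrightarrow> y \<le> z \<Longrightarrow> z \<le> b \<Longrightarrow> F x z \<le> F x y + F y z"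
    and K: "\<And>x y z. a \<le> x \<Longrightarrow> x \<le> y \<Longrightarrow> y \<le> z \<Longrightarrow> z \<le> b \<Longrightarrow> K x y + K y z \<le> K x z"
    and loc: "\<And>t e. 0 < e \<Longrightarrow> a \<le> t \<Longrightarrow> t \<le> b \<Longrightarrow>
      \<exists>d>0. \<forall>x y. a \<le> x \<longrightarrow> x \<le> t \<longrightarrow> t \<le> y \<longrightarrow> y \<le> b \<longrightarrow> y - x < d \<longrightarrow> F x y \<le> e * K x y"
  shows "F a b \<le> 0"
proof -
  have small: "F a b \<le> e * K a b" if e: "e > 0" for e
  proof -
    have "a \<le> a \<and> b \<le> b \<longrightarrow> F a b \<le> e * K a b"
    proof (rule Bolzano[OF ab, where P = "\<lambda>x y. a \<le> x \<and> y \<le> b \<longrightarrow> F x y \<le> e * K x y"])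
      fix x y z
      assume *: "a \<le> x \<and> y \<le> b \<longrightarrow> F x y \<le> e * K x y" "a \<le> y \<and> z \<le> b \<longrightarrow> F y z \<le> e * K y z"
        "x \<le> y" "y \<le> z"
      show "a \<le> x \<and> z \<le> b \<longrightarrow> F x z \<le> e * K x z"
      proof
        assume "a \<le> x \<and> z \<le> b"
        then have "F x z \<le> F x y + F y z" "F x y \<le> e * K x y" "F y z \<le> e * K y z"
          "e * (K x y + K y z) \<le> e * K x z"
          using * F[of x y z] K[of x y z] e by auto
        then show "F x z \<le> e * K x z" by (simp add: distrib_left)
      qed
    next
      fix t assume "a \<le> t" "t \<le> b"
      from loc[OF e this] obtain d where "d > 0"
        "\<And>x y. a \<le> x \<Longrightarrow> x \<le> t \<Longrightarrow> t \<le> y \<Longrightarrow> y \<le> b \<Longrightarrow> y - x < d \<Longrightarrow> F x y \<le> e * K x y"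
        by blast
      then show "\<exists>d>0. \<forall>x y. x \<le> t \<and> t \<le> y \<and> y - x < d \<longrightarrow> a \<le> x \<and> y \<le> b \<longrightarrow> F x y \<le> e * K x y"
        by (intro exI[of _ d]) auto
    qed
    then show ?thesis by simp
  qed
  show ?thesis
  proof (rule ccontr)
    assume "\<not> F a b \<le> 0"
    then have Fpos: "F a b > 0" by simp
    with small[of 1] have "K a b > 0" by simp
    with Fpos small[of "F a b / (2 * K a b)"] show False by simp
  qed
qed

text \<open>Local absolute continuity of \<open>U\<close> with derivative \<open>g\<close>, encoded
  by integrals so that differentiability almost everywhere never has to be discussed.\<close>

definition primitive :: "(real \<Rightarrow> complex) \<Rightarrow> (real \<Rightarrow> complex) \<Rightarrow> bool" where
  "primitive g U \<longleftrightarrow> locally_integrable g \<and> (\<forall>x y. x \<le> y \<longrightarrow> U y - U x = integral {x..y} g)"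

lemma primitive_locally_integrable: "primitive g U \<Longrightarrow> locally_integrable g"
  by (simp add: primitive_def)

lemma primitive_diff: "primitive g U \<Longrightarrow> x \<le> y \<Longrightarrow> U y - U x = integral {x..y} g"
  by (simp add: primitive_def)

lemma primitive_continuous:
  assumes "primitive g U"
  shows "continuous_on S U"
proof (rule continuous_at_imp_continuous_on, rule ballI)
  fix x
  have "continuous_on {x-1..x+1} (\<lambda>y. U (x-1) + integral {x-1..y} g)"
    using assms by (intro continuous_intros indefinite_integral_continuous_1
        locally_integrable_integrable_on primitive_locally_integrable)
  then have "continuous_on {x-1..x+1} U"
    by (rule continuous_on_eq) (use assms in \<open>auto simp: primitive_diff[symmetric]\<close>)
  then show "isCont U x"
    by (rule continuous_on_interior) (auto simp: interior_atLeastAtMost_real)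
qed

lemma primitive_norm_diff_le:
  assumes "primitive g U" "x \<le> y"
  shows "cmod (U y - U x) \<le> integral {x..y} (\<lambda>t. cmod (g t))"
  unfolding primitive_diff[OF assms]
  using primitive_locally_integrable[OF assms(1)]
  by (intro integral_norm_bound_integral locally_integrable_integrable_on
      locally_integrable_norm_integrable_on) auto

text \<open>Writing the increment of the product as
  \<open>(U y - U x) * V y + U x * (V y - V x)\<close> exhibits the defect of the product rule as
  the integral of \<open>g s * (V y - V s) + (U x - U s) * h s\<close>. By continuity this is at
  most \<open>e\<close> times the integral of the norms on short intervals.\<close>

lemma primitive_mult:
  assumes U: "primitive g U" and V: "primitive h V"
  shows "primitive (\<lambda>x. g x * V x + U x * h x) (\<lambda>x. U x * V x)"
proof -
  note ig = primitive_locally_integrable[OF U] and ih = primitive_locally_integrable[OF V]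
  have "locally_integrable (\<lambda>x. g x * V x + h x * U x)"
    using U V by (intro locally_integrable_add locally_integrable_mult_continuous primitive_continuous ig ih)
  then have li: "locally_integrable (\<lambda>x. g x * V x + U x * h x)"
    by (simp add: mult.commute)
  let ?f = "\<lambda>x. g x * V x + U x * h x"
  define K where "K x y = integral {x..y} (\<lambda>s. cmod (g s) + cmod (h s))" for x y
  define F where "F x y = cmod (U y * V y - U x * V x - integral {x..y} ?f)" for x y
  have iK: "(\<lambda>s. cmod (g s) + cmod (h s)) integrable_on {x..y}" for x y
    by (intro integrable_add locally_integrable_norm_integrable_on ig ih)
  have "F a b \<le> 0" if "a \<le> b" for a b
  proof (rule subadditive_interval_nonpos[OF that])
    fix x y z :: real assume "x \<le> y" "y \<le> z"
    then have split: "integral {x..z} ?f = integral {x..y} ?f + integral {y..z} ?f"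
      by (rule Henstock_Kurzweil_Integration.integral_combine[symmetric, OF _ _ locally_integrable_integrable_on[OF li]])
    have "U z * V z - U x * V x - integral {x..z} ?f =
        (U y * V y - U x * V x - integral {x..y} ?f) + (U z * V z - U y * V y - integral {y..z} ?f)"
      by (simp add: split)
    then show "F x z \<le> F x y + F y z"
      unfolding F_def by (simp only: norm_triangle_ineq)
    show "K x y + K y z \<le> K x z"
      unfolding K_def using \<open>x \<le> y\<close> \<open>y \<le> z\<close> iK by (simp add: Henstock_Kurzweil_Integration.integral_combine)
  next
    fix t e :: real assume e: "0 < e"
    have "isCont U t" "isCont V t"
      using primitive_continuous[OF U, of UNIV] primitive_continuous[OF V, of UNIV]
      by (auto simp: continuous_on_eq_continuous_at)
    then have near: "\<exists>d>0. \<forall>s. dist s t < d \<longrightarrow> dist (U s) (U t) < e / 2"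
      "\<exists>d>0. \<forall>s. dist s t < d \<longrightarrow> dist (V s) (V t) < e / 2"
      using half_gt_zero[OF e] unfolding continuous_at_eps_delta by blast+
    obtain d1 where d1: "d1 > 0" "\<And>s. \<bar>s - t\<bar> < d1 \<Longrightarrow> dist (U s) (U t) < e / 2"
      using near(1) by (auto simp: dist_real_def)
    obtain d2 where d2: "d2 > 0" "\<And>s. \<bar>s - t\<bar> < d2 \<Longrightarrow> dist (V s) (V t) < e / 2"
      using near(2) by (auto simp: dist_real_def)
    have "F x y \<le> e * K x y" if xy: "x \<le> t" "t \<le> y" "y - x < min d1 d2" for x y
    proof -
      have i: "(\<lambda>s. g s * V y) integrable_on {x..y}" "(\<lambda>s. U x * h s) integrable_on {x..y}"
        using locally_integrable_integrable_on[OF ig] locally_integrable_integrable_on[OF ih]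
        by (auto intro: integrable_on_mult_left integrable_on_mult_right)
      then have "(\<lambda>s. g s * V y + U x * h s) integrable_on {x..y}"
        by (rule integrable_add)
      moreover have "integral {x..y} (\<lambda>s. g s * V y + U x * h s) =
          integral {x..y} g * V y + U x * integral {x..y} h"
        by (simp add: integral_add[OF i])
      moreover have "integral {x..y} g = U y - U x" "integral {x..y} h = V y - V x"
        using xy primitive_diff[OF U, of x y] primitive_diff[OF V, of x y] by auto
      moreover have "?f integrable_on {x..y}" by (rule locally_integrable_integrable_on[OF li])
      ultimately have *: "((\<lambda>s. (g s * V y + U x * h s) - ?f s) has_integral
          U y * V y - U x * V x - integral {x..y} ?f) {x..y}"
        by (subst has_integral_integrable_integral)
           (auto intro!: integrable_diff simp: integral_diff algebra_simps)
      have "norm (U y * V y - U x * V x - integral {x..y} ?f) \<le>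
          integral {x..y} (\<lambda>s. e * (cmod (g s) + cmod (h s)))"
      proof (subst integral_unique[OF *, symmetric], rule integral_norm_bound_integral)
        show "(\<lambda>s. e * (cmod (g s) + cmod (h s))) integrable_on {x..y}"
          by (intro integrable_on_mult_right iK)
        fix s assume s: "s \<in> {x..y}"
        have "dist (U x) (U s) \<le> e" "dist (V y) (V s) \<le> e"
          using dist_triangle_half_r[of "U t" "U x" e "U s"] dist_triangle_half_r[of "V t" "V y" e "V s"]
            d1(2)[of x] d1(2)[of s] d2(2)[of y] d2(2)[of s] s xy
          by (auto simp: dist_commute)
        then have 1: "cmod (U x - U s) \<le> e" "cmod (V y - V s) \<le> e" by (auto simp: dist_norm)
        have "g s * V y + U x * h s - ?f s = g s * (V y - V s) + (U x - U s) * h s"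
          by (simp add: algebra_simps)
        also have "norm \<dots> \<le> cmod (g s) * cmod (V y - V s) + cmod (U x - U s) * cmod (h s)"
          by (rule norm_triangle_le) (simp add: norm_mult)
        also have "\<dots> \<le> cmod (g s) * e + e * cmod (h s)"
          by (intro add_mono mult_mono 1) (use e in auto)
        finally show "norm (g s * V y + U x * h s - ?f s) \<le> e * (cmod (g s) + cmod (h s))"
          by (simp add: algebra_simps)
      qed (use * in blast)
      then show ?thesis by (simp add: F_def K_def)
    qed
    then show "\<exists>d>0. \<forall>x y. a \<le> x \<longrightarrow> x \<le> t \<longrightarrow> t \<le> y \<longrightarrow> y \<le> b \<longrightarrow> y - x < d \<longrightarrow> F x y \<le> e * K x y"
      using d1(1) d2(1) by (intro exI[of _ "min d1 d2"]) auto
  qed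
  then have "U b * V b - U a * V a = integral {a..b} ?f" if "a \<le> b" for a b
    using that by (auto simp: F_def)
  with li show ?thesis by (simp add: primitive_def)
qed

lemma primitiveI_derivative:
  assumes "\<And>x. (f has_real_derivative f' x) (at x)" "continuous_on UNIV f'"
  shows "primitive (\<lambda>x. complex_of_real (f' x)) (\<lambda>x. complex_of_real (f x))"
  unfolding primitive_def
proof (intro conjI allI impI)
  show "locally_integrable (\<lambda>x. complex_of_real (f' x))"
    using assms by (intro locally_integrable_continuous continuous_intros)
  fix x y :: real assume "x \<le> y"
  then have "((\<lambda>x. complex_of_real (f' x)) has_integral complex_of_real (f y) - complex_of_real (f x)) {x..y}"
    by (intro fundamental_theorem_of_calculus has_vector_derivative_of_real
        has_vector_derivative_at_within assms(1))
  then show "complex_of_real (f y) - complex_of_real (f x) = integral {x..y} (\<lambda>x. complex_of_real (f' x))"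
    by (simp add: integral_unique)
qed

lemma primitive_imp_weak_deriv:
  assumes U: "primitive g U"
  shows "has_weak_deriv U g"
  unfolding has_weak_deriv_def
proof (intro conjI allI impI)
  show ig: "locally_integrable g" by (rule primitive_locally_integrable[OF U])
  show iU: "locally_integrable U" by (intro locally_integrable_continuous primitive_continuous[OF U])
  fix \<phi> assume "test_function \<phi>"
  then obtain a b where \<phi>: "a \<le> b" "\<And>x. x \<notin> {a..b} \<Longrightarrow> \<phi> x = 0" "\<And>x. x \<notin> {a..b} \<Longrightarrow> deriv \<phi> x = 0"
    "\<And>x. (\<phi> has_real_derivative deriv \<phi> x) (at x)" "\<And>S. continuous_on S (deriv \<phi>)"
    by (elim test_functionE) blast
  \<comment> \<open>Enlarged by 1 on both sides because \<phi> is known to vanish only strictly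
    outside \<open>{a..b}\<close>; the boundary terms then drop out.\<close>
  let ?I = "{a-1..b+1}"
  have V: "primitive (\<lambda>x. complex_of_real (deriv \<phi> x)) (\<lambda>x. complex_of_real (\<phi> x))"
    using \<phi> by (intro primitiveI_derivative)
  have 1: "(\<lambda>x. g x * complex_of_real (\<phi> x)) absolutely_integrable_on ?I"
    by (intro locally_integrable_Icc locally_integrable_mult_continuous ig primitive_continuous[OF V])
  have 2: "(\<lambda>x. U x * complex_of_real (deriv \<phi> x)) absolutely_integrable_on ?I"
    by (intro locally_integrable_Icc locally_integrable_mult_continuous iU continuous_intros \<phi>)
  have "integral ?I (\<lambda>x. g x * complex_of_real (\<phi> x)) + integral ?I (\<lambda>x. U x * complex_of_real (deriv \<phi> x))
    = U (b+1) * complex_of_real (\<phi> (b+1)) - U (a-1) * complex_of_real (\<phi> (a-1))"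
    using primitive_diff[OF primitive_mult[OF U V], of "a-1" "b+1"] 1 2 \<phi>(1)
    by (simp add: integral_add absolutely_integrable_on_def)
  also have "\<dots> = 0" using \<phi>(2) by simp
  finally show "(LINT x|lebesgue. U x * complex_of_real (deriv \<phi> x)) =
      - (LINT x|lebesgue. g x * complex_of_real (\<phi> x))"
    using \<phi>(2,3)
    by (subst integral_vanishing_outside[OF 1], force, subst integral_vanishing_outside[OF 2], force)
       (simp add: eq_neg_iff_add_eq_0 add.commute)
qed

section \<open>Continuous representatives of weakly differentiable functions\<close>

lemma test_integrable:
  assumes "locally_integrable f" "test_function \<phi>"
  shows "integrable lebesgue (\<lambda>x. f x * complex_of_real (\<phi> x))"
    "integrable lebesgue (\<lambda>x. f x * complex_of_real (deriv \<phi> x))"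
proof -
  obtain a b where \<phi>: "\<And>x. x \<notin> {a..b} \<Longrightarrow> \<phi> x = 0" "\<And>x. x \<notin> {a..b} \<Longrightarrow> deriv \<phi> x = 0"
    "\<And>x. (\<phi> has_real_derivative deriv \<phi> x) (at x)" "\<And>S. continuous_on S (deriv \<phi>)"
    using assms(2) by (elim test_functionE) blast
  have cont: "continuous_on UNIV \<phi>"
    using \<phi>(3) by (meson DERIV_isCont continuous_at_imp_continuous_on)
  have 1: "(\<lambda>x. f x * complex_of_real (\<phi> x)) absolutely_integrable_on {a..b}"
    by (intro locally_integrable_Icc locally_integrable_mult_continuous assms continuous_intros cont)
  have 2: "(\<lambda>x. f x * complex_of_real (deriv \<phi> x)) absolutely_integrable_on {a..b}"
    by (intro locally_integrable_Icc locally_integrable_mult_continuous assms continuous_intros \<phi>)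
  show "integrable lebesgue (\<lambda>x. f x * complex_of_real (\<phi> x))"
    by (rule integrable_vanishing_outside[OF 1]) (use \<phi>(1) in force)
  show "integrable lebesgue (\<lambda>x. f x * complex_of_real (deriv \<phi> x))"
    by (rule integrable_vanishing_outside[OF 2]) (use \<phi>(2) in force)
qed

lemma has_weak_deriv_unique:
  assumes f: "has_weak_deriv f g" "has_weak_deriv f h"
  shows "AE x in lebesgue. g x = h x"
proof -
  have ig: "locally_integrable g" "locally_integrable h" using f by (auto simp: has_weak_deriv_def)
  have "AE x in lebesgue. g x - h x = 0"
  proof (rule fundamental_lemma)
    show "locally_integrable (\<lambda>x. g x - h x)" by (intro locally_integrable_diff ig)
    fix a b :: real and n
    have t: "test_function (bump a b n)"
      by (rule test_function_flat_algebra[OF flat_algebra_bump, of a b]) (auto simp: bump_outside)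
    have "(LINT x|lebesgue. g x * complex_of_real (bump a b n x)) = (LINT x|lebesgue. h x * complex_of_real (bump a b n x))"
      using f[unfolded has_weak_deriv_def, THEN conjunct2, THEN conjunct2, rule_format, OF t]
      by simp
    then show "(LINT x|lebesgue. (g x - h x) * complex_of_real (bump a b n x)) = 0"
      using test_integrable(1)[OF ig(1) t] test_integrable(1)[OF ig(2) t]
      by (simp add: left_diff_distrib)
  qed
  then show ?thesis by simp
qed

lemma primitive_exists:
  assumes g: "locally_integrable g"
  obtains U where "primitive g U"
proof -
  \<comment> \<open>A signed integral from 0 to x: at least one of the two intervals is empty or a
    point and contributes 0.\<close>
  define U where "U x = integral {0..x} g - integral {x..0} g" for x
  note i = locally_integrable_integrable_on[OF g]
  have empty: "integral {x..y} g = 0" if "y \<le> x" for x y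
    using that by (cases "x = y") auto
  have "U y - U x = integral {x..y} g" if "x \<le> y" for x y
  proof -
    consider "0 \<le> x" | "x \<le> 0" "0 \<le> y" | "y \<le> 0" by linarith
    then show ?thesis
    proof cases
      case 1
      then show ?thesis using that Henstock_Kurzweil_Integration.integral_combine[OF _ _ i, of 0 x y] by (simp add: U_def empty algebra_simps)
    next
      case 2
      then show ?thesis using Henstock_Kurzweil_Integration.integral_combine[OF _ _ i, of x 0 y] by (simp add: U_def empty algebra_simps)
    next
      case 3
      then show ?thesis using that Henstock_Kurzweil_Integration.integral_combine[OF _ _ i, of x y 0] by (simp add: U_def empty algebra_simps)
    qed
  qed
  with g have "primitive g U" by (simp add: primitive_def)
  then show ?thesis by (rule that)
qed

text \<open>\<open>u\<close> minus any primitive of \<open>g\<close> has weak derivative 0, hence is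
  constant almost everywhere; the constant is absorbed into the primitive.\<close>

lemma has_weak_deriv_imp_primitive:
  assumes u: "has_weak_deriv u g"
  obtains U where "primitive g U" "AE x in lebesgue. u x = U x"
proof -
  have lg: "locally_integrable g" and lu: "locally_integrable u" using u by (auto simp: has_weak_deriv_def)
  obtain V where V: "primitive g V" using primitive_exists[OF lg] .
  have wV: "has_weak_deriv V g" by (rule primitive_imp_weak_deriv[OF V])
  then have lV: "locally_integrable V" by (auto simp: has_weak_deriv_def)
  obtain c where c: "AE x in lebesgue. u x - V x = c"
  proof (rule du_Bois_Reymond[of "\<lambda>x. u x - V x"])
    show "locally_integrable (\<lambda>x. u x - V x)" by (intro locally_integrable_diff lu lV)
    fix \<phi> assume t: "test_function \<phi>"
    have "(LINT x|lebesgue. u x * complex_of_real (deriv \<phi> x)) = (LINT x|lebesgue. V x * complex_of_real (deriv \<phi> x))"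
      using u wV t unfolding has_weak_deriv_def by simp
    then show "(LINT x|lebesgue. (u x - V x) * complex_of_real (deriv \<phi> x)) = 0"
      using test_integrable(2)[OF lu t] test_integrable(2)[OF lV t]
      by (simp add: left_diff_distrib)
  qed blast
  show ?thesis
  proof (rule that)
    show "primitive g (\<lambda>x. V x + c)" using V by (simp add: primitive_def)
    show "AE x in lebesgue. u x = V x + c" using c by eventually_elim (simp add: algebra_simps)
  qed
qed

lemma has_weak_deriv_cong_AE:
  assumes u: "has_weak_deriv u g" and eq: "AE x in lebesgue. u x = v x"
  shows "has_weak_deriv v g"
proof -
  have neg: "negligible {x. u x \<noteq> v x}"
    using eq by (simp add: completion.AE_iff_null_sets negligible_iff_null_sets)
  have u_int: "u absolutely_integrable_on {a..b}" for a b
    using u by (simp add: has_weak_deriv_def locally_integrable_Icc)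
  have "v absolutely_integrable_on {a..b}" for a b
    by (rule absolutely_integrable_spike[OF u_int neg]) auto
  then have "locally_integrable v" by (simp add: locally_integrable_def)
  moreover have "(LINT x|lebesgue. v x * complex_of_real (deriv \<phi> x)) = (LINT x|lebesgue. u x * complex_of_real (deriv \<phi> x))"
    if t: "test_function \<phi>" for \<phi>
  proof (rule integral_cong_AE)
    show *: "(\<lambda>x. v x * complex_of_real (deriv \<phi> x)) \<in> borel_measurable lebesgue"
      by (rule borel_measurable_integrable[OF test_integrable(2)[OF \<open>locally_integrable v\<close> t]])
    show "(\<lambda>x. u x * complex_of_real (deriv \<phi> x)) \<in> borel_measurable lebesgue"
      using u by (intro borel_measurable_integrable test_integrable(2)[OF _ t]) (simp add: has_weak_deriv_def)
    show "AE x in lebesgue. v x * complex_of_real (deriv \<phi> x) = u x * complex_of_real (deriv \<phi> x)"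
      using eq by eventually_elim simp
  qed
  ultimately show ?thesis using u unfolding has_weak_deriv_def by simp
qed

text \<open>Frees the energy from the arbitrary choice in \<open>weak_deriv\<close>: all weak
  derivatives agree almost everywhere.\<close>

lemma weak_deriv_square_integral:
  assumes g: "has_weak_deriv u g" "g \<in> borel_measurable lebesgue"
  shows "(LINT x|lebesgue. (cmod (weak_deriv u x))\<^sup>2) = (LINT x|lebesgue. (cmod (g x))\<^sup>2)"
proof -
  have "has_weak_deriv u (weak_deriv u)"
    unfolding weak_deriv_def by (rule someI[of "has_weak_deriv u", OF g(1)])
  then have ae: "AE x in lebesgue. g x = weak_deriv u x"
    by (rule has_weak_deriv_unique[OF g(1)])
  have "weak_deriv u \<in> borel_measurable lebesgue" by (rule borel_measurable_AE[OF g(2) ae])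
  with g(2) ae show ?thesis by (intro integral_cong_AE) auto
qed

text \<open>All pointwise arguments, such as the choice of a maximum point, are made for the
  continuous representative \<open>v\<close>; mass and energy do not notice the change.\<close>

lemma H1_E:
  assumes u: "u \<in> H1"
  obtains v g where "primitive g v" "AE x in lebesgue. u x = v x"
    "v \<in> L2" "g \<in> L2"
    "(LINT x|lebesgue. (cmod (weak_deriv u x))\<^sup>2) = (LINT x|lebesgue. (cmod (g x))\<^sup>2)"
proof -
  obtain g where g: "g \<in> L2" "has_weak_deriv u g" and uL: "u \<in> L2" using u by (auto simp: H1_def)
  obtain v where v: "primitive g v" "AE x in lebesgue. u x = v x"
    using has_weak_deriv_imp_primitive[OF g(2)] .
  have um: "u \<in> borel_measurable lebesgue" using uL by (auto simp: L2_def)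
  have vm: "v \<in> borel_measurable lebesgue" by (rule borel_measurable_AE[OF um v(2)])
  have "integrable lebesgue (\<lambda>x. (cmod (u x))\<^sup>2) \<longleftrightarrow> integrable lebesgue (\<lambda>x. (cmod (v x))\<^sup>2)"
    using um vm v(2) by (intro integrable_cong_AE) auto
  then have "v \<in> L2" using uL vm by (auto simp: L2_def)
  moreover have "(LINT x|lebesgue. (cmod (weak_deriv u x))\<^sup>2) = (LINT x|lebesgue. (cmod (g x))\<^sup>2)"
    using g by (intro weak_deriv_square_integral) (auto simp: L2_def)
  ultimately show ?thesis using that v g by blast
qed

text \<open>An estimate for \<open>H \<circ> v\<close> which bypasses the almost everywhere differentiability of \<open>v\<close>.\<close>

lemma chain_rule_le:
  fixes v h :: "real \<Rightarrow> real"
  assumes ab: "a \<le> b" and v: "continuous_on {a..b} v" "v ` {a..b} \<subseteq> {p..q}"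
    and h: "h absolutely_integrable_on {a..b}"
    and lip: "\<And>x y. a \<le> x \<Longrightarrow> x \<le> y \<Longrightarrow> y \<le> b \<Longrightarrow> \<bar>v y - v x\<bar> \<le> integral {x..y} h"
    and H: "continuous_on {p..q} H" "\<And>s. p < s \<Longrightarrow> s < q \<Longrightarrow> (H has_real_derivative G s) (at s)"
    and G: "continuous_on {p..q} G"
    and h0: "\<And>x. h x \<ge> 0"
  shows "\<bar>H (v b) - H (v a)\<bar> \<le> integral {a..b} (\<lambda>x. h x * \<bar>G (v x)\<bar>)"
proof -
  have cGv: "continuous_on {a..b} (\<lambda>x. \<bar>G (v x)\<bar>)"
    using continuous_on_compose2[OF G v(1)] v(2) by (intro continuous_intros) auto
  have ihG: "(\<lambda>x. h x * \<bar>G (v x)\<bar>) integrable_on {a..b}"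
    using absolutely_integrable_continuous_mult[OF cGv h]
    by (simp add: absolutely_integrable_on_def mult.commute)
  have ihG': "(\<lambda>x. h x * \<bar>G (v x)\<bar>) integrable_on {x..y}" if "a \<le> x" "y \<le> b" for x y
    using ihG that by (auto intro: integrable_on_subinterval)
  have ih: "h integrable_on {x..y}" if "a \<le> x" "y \<le> b" for x y
    using h that by (auto simp: absolutely_integrable_on_def intro: integrable_on_subinterval)
  define F where "F x y = \<bar>H (v y) - H (v x)\<bar> - integral {x..y} (\<lambda>x. h x * \<bar>G (v x)\<bar>)" for x y
  have "F a b \<le> 0"
  proof (rule subadditive_interval_nonpos[OF ab, where K = "\<lambda>x y. integral {x..y} h"])
    fix x y z assume *: "a \<le> x" "x \<le> y" "y \<le> z" "z \<le> b"
    have "integral {x..z} (\<lambda>x. h x * \<bar>G (v x)\<bar>) = integral {x..y} (\<lambda>x. h x * \<bar>G (v x)\<bar>) + integral {y..z} (\<lambda>x. h x * \<bar>G (v x)\<bar>)"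
      using * ihG' by (subst Henstock_Kurzweil_Integration.integral_combine) auto
    then show "F x z \<le> F x y + F y z" by (simp add: F_def)
    show "integral {x..y} h + integral {y..z} h \<le> integral {x..z} h"
      using * ih by (subst Henstock_Kurzweil_Integration.integral_combine) auto
  next
    fix t e :: real assume e: "0 < e" and t: "a \<le> t" "t \<le> b"
    have tq: "v t \<in> {p..q}" using t v(2) by (meson atLeastAtMost_iff image_subset_iff)
    have "e / 2 > 0" using e by simp
    with G tq obtain d1 where d1: "d1 > 0" "\<And>s. s \<in> {p..q} \<Longrightarrow> \<bar>s - v t\<bar> < d1 \<Longrightarrow> \<bar>G s - G (v t)\<bar> < e / 2"
      unfolding continuous_on_iff dist_real_def by blast
    from v(1) t d1(1) obtain d where d: "d > 0" "\<And>s. s \<in> {a..b} \<Longrightarrow> \<bar>s - t\<bar> < d \<Longrightarrow> \<bar>v s - v t\<bar> < d1"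
      unfolding continuous_on_iff dist_real_def by (metis atLeastAtMost_iff)
    have "F x y \<le> e * integral {x..y} h" if xy: "a \<le> x" "x \<le> t" "t \<le> y" "y \<le> b" "y - x < d" for x y
    proof -
      have near: "v s \<in> {p..q} \<and> \<bar>v s - v t\<bar> < d1" if "s \<in> {x..y}" for s
        using that xy t d(2)[of s] v(2) by (auto simp: image_subset_iff)
      have mvt: "\<bar>H z - H w\<bar> \<le> (\<bar>G (v t)\<bar> + e / 2) * \<bar>z - w\<bar>"
        if "w < z" "w \<in> {p..q}" "z \<in> {p..q}" "\<bar>w - v t\<bar> < d1" "\<bar>z - v t\<bar> < d1" for w z
      proof -
        have "continuous_on {w..z} H" using H(1) that by (auto intro: continuous_on_subset)
        moreover have D: "(H has_real_derivative G s) (at s)" if "w < s" "s < z" for s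
          using H(2)[of s] that \<open>w \<in> {p..q}\<close> \<open>z \<in> {p..q}\<close> by auto
        ultimately obtain l \<xi> where \<xi>l: "w < \<xi>" "\<xi> < z" "DERIV H \<xi> :> l" "H z - H w = (z - w) * l"
          using MVT[of w z H] \<open>w < z\<close> by (meson real_differentiable_def)
        then have \<xi>: "w < \<xi>" "\<xi> < z" "H z - H w = (z - w) * G \<xi>"
          using DERIV_unique D by blast+
        then have "\<bar>G \<xi> - G (v t)\<bar> < e / 2" using d1(2)[of \<xi>] that by auto
        then have "\<bar>G \<xi>\<bar> \<le> \<bar>G (v t)\<bar> + e / 2" by linarith
        then show ?thesis using \<xi> by (simp add: abs_mult mult.commute mult_left_mono)
      qed
      have "\<bar>H (v y) - H (v x)\<bar> \<le> (\<bar>G (v t)\<bar> + e / 2) * \<bar>v y - v x\<bar>"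
        using mvt[of "v x" "v y"] mvt[of "v y" "v x"] near[of x] near[of y] xy
        by (cases "v x" "v y" rule: linorder_cases) (auto simp: abs_minus_commute)
      also have "\<dots> \<le> (\<bar>G (v t)\<bar> + e / 2) * integral {x..y} h"
        using lip[of x y] xy e by (intro mult_left_mono) auto
      also have "\<dots> = integral {x..y} (\<lambda>s. h s * (\<bar>G (v t)\<bar> + e / 2))"
        by (simp add: mult.commute)
      \<comment> \<open>Half of \<open>e\<close> paid for the mean value estimate with
        \<open>G\<close> frozen at \<open>v t\<close>; the other half pays for releasing it to
        \<open>v s\<close>.\<close>
      also have "\<dots> \<le> integral {x..y} (\<lambda>s. h s * \<bar>G (v s)\<bar> + e * h s)"
      proof (rule integral_le)
        show "(\<lambda>s. h s * (\<bar>G (v t)\<bar> + e / 2)) integrable_on {x..y}"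
          using ih xy by (intro integrable_on_mult_left) auto
        show "(\<lambda>s. h s * \<bar>G (v s)\<bar> + e * h s) integrable_on {x..y}"
          using ih ihG' xy by (intro integrable_add integrable_on_mult_right) auto
        fix s assume s: "s \<in> {x..y}"
        have "\<bar>G (v s) - G (v t)\<bar> < e / 2" using near[OF s] d1(2) by blast
        then have "\<bar>G (v t)\<bar> + e / 2 \<le> \<bar>G (v s)\<bar> + e" by linarith
        then have "h s * (\<bar>G (v t)\<bar> + e / 2) \<le> h s * (\<bar>G (v s)\<bar> + e)" using h0 by (intro mult_left_mono)
        then show "h s * (\<bar>G (v t)\<bar> + e / 2) \<le> h s * \<bar>G (v s)\<bar> + e * h s" by (simp add: algebra_simps)
      qed
      also have "\<dots> = integral {x..y} (\<lambda>s. h s * \<bar>G (v s)\<bar>) + e * integral {x..y} h"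
        using ih ihG' xy by (subst integral_add) (auto intro: integrable_on_mult_right)
      finally show ?thesis by (simp add: F_def)
    qed
    then show "\<exists>d>0. \<forall>x y. a \<le> x \<longrightarrow> x \<le> t \<longrightarrow> t \<le> y \<longrightarrow> y \<le> b \<longrightarrow> y - x < d \<longrightarrow> F x y \<le> e * integral {x..y} h"
      using d by blast
  qed
  then show ?thesis by (simp add: F_def)
qed

section \<open>The scalar energy inequality\<close>

lemma integrable_lebesgue_Icc:
  fixes q :: "real \<Rightarrow> 'a::euclidean_space"
  assumes "integrable lebesgue q"
  shows "q absolutely_integrable_on {a..b}"
  using integrable_mult_indicator[OF _ assms, of "{a..b}"] by (simp add: set_integrable_def)

lemma integral_Icc_le_LINT:
  fixes q :: "real \<Rightarrow> real"
  assumes q: "integrable lebesgue q" "\<And>x. q x \<ge> 0"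
  shows "integral {x..y} q \<le> (LINT t|lebesgue. q t)"
proof -
  have "integral {x..y} q = (LINT t:{x..y}|lebesgue. q t)"
    using set_lebesgue_integral_eq_integral(2)[OF integrable_lebesgue_Icc[OF q(1)]] by simp
  also have "\<dots> \<le> (LINT t|lebesgue. q t)"
    unfolding set_lebesgue_integral_def
    by (rule integral_mono[OF integrable_mult_indicator[OF _ q(1)] q(1)])
       (auto simp: indicator_def q(2))
  finally show ?thesis .
qed

lemma integrable_tail_small:
  fixes q :: "real \<Rightarrow> real"
  assumes q: "integrable lebesgue q" "\<And>x. q x \<ge> 0" and e: "e > 0"
  obtains N where "\<And>x y. x \<le> y \<Longrightarrow> N \<le> x \<or> y \<le> - N \<Longrightarrow> integral {x..y} q < e"
proof -
  let ?J = "LINT t|lebesgue. q t"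
  have "(\<lambda>n. LINT t|lebesgue. indicator {-real n..real n} t *\<^sub>R q t) \<longlonglongrightarrow> ?J"
  proof (rule integral_dominated_convergence[where w = q])
    show "AE t in lebesgue. (\<lambda>n. indicator {-real n..real n} t *\<^sub>R q t) \<longlonglongrightarrow> q t"
    proof (rule AE_I2)
      fix t
      obtain n0 where n0: "\<bar>t\<bar> \<le> real n0" using real_arch_simple by blast
      have "indicator {-real n..real n} t *\<^sub>R q t = q t" if "n \<ge> n0" for n
        using n0 that by (auto simp: indicator_def)
      then show "(\<lambda>n. indicator {-real n..real n} t *\<^sub>R q t) \<longlonglongrightarrow> q t"
        by (intro tendsto_eventually) (auto simp: eventually_sequentially)
    qed
    show "(\<lambda>t. indicator {-real n..real n} t *\<^sub>R q t) \<in> borel_measurable lebesgue" for n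
      by (intro borel_measurable_integrable integrable_mult_indicator q) auto
  qed (use q in \<open>auto simp: indicator_def\<close>)
  then have "eventually (\<lambda>n. (LINT t|lebesgue. indicator {-real n..real n} t *\<^sub>R q t) > ?J - e) sequentially"
    using e by (intro order_tendstoD) auto
  then obtain n where n: "(LINT t:{-real n..real n}|lebesgue. q t) > ?J - e"
    unfolding set_lebesgue_integral_def by (auto simp: eventually_sequentially)
  have io: "q integrable_on {x..y}" for x y
    using integrable_lebesgue_Icc[OF q(1)] by (simp add: absolutely_integrable_on_def)
  have mono: "0 \<le> integral {x..y} q" for x y by (intro integral_nonneg io q(2))
  have n': "integral {-real n..real n} q > ?J - e"
    using n set_lebesgue_integral_eq_integral(2)[OF integrable_lebesgue_Icc[OF q(1)]] by simp
  have "integral {x..y} q < e" if xy: "x \<le> y" "real n \<le> x \<or> y \<le> - real n" for x y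
    using xy(2)
  proof
    assume "real n \<le> x"
    then have "integral {-real n..real n} q + integral {real n..x} q + integral {x..y} q = integral {-real n..y} q"
      using xy(1) io by (simp add: Henstock_Kurzweil_Integration.integral_combine)
    then show ?thesis
      using integral_Icc_le_LINT[OF q, of "- real n" y] mono[of "real n" x] n' by linarith
  next
    assume "y \<le> - real n"
    then have "integral {x..y} q + integral {y..-real n} q + integral {-real n..real n} q = integral {x..real n} q"
      using xy(1) io by (simp add: Henstock_Kurzweil_Integration.integral_combine)
    then show ?thesis
      using integral_Icc_le_LINT[OF q, of x "real n"] mono[of y "- real n"] n' by linarith
  qed
  then show ?thesis by (rule that)
qed

section \<open>Oscillation, decay and maximum of the modulus\<close>

text \<open>Stands in for the bound of the derivative of |v| by |g|. Increments are all that
  \<open>chain_rule_le\<close> asks for, so zeros of \<open>v\<close>, where the modulus may have a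
  kink, need no special care.\<close>

lemma cmod_primitive_lipschitz:
  assumes "primitive g v" "x \<le> y"
  shows "\<bar>cmod (v y) - cmod (v x)\<bar> \<le> integral {x..y} (\<lambda>t. cmod (g t))"
  using norm_triangle_ineq3[of "v y" "v x"] primitive_norm_diff_le[OF assms] by linarith

lemma primitive_cmod_continuous: "primitive g v \<Longrightarrow> continuous_on S (\<lambda>x. cmod (v x))"
  by (intro continuous_intros primitive_continuous)

lemma primitive_chain_rule:
  assumes v: "primitive g v" and xy: "x \<le> y" and range: "(\<lambda>t. cmod (v t)) ` {x..y} \<subseteq> {p..q}"
    and H: "continuous_on {p..q} H" "\<And>s. p < s \<Longrightarrow> s < q \<Longrightarrow> (H has_real_derivative G s) (at s)"
    and G: "continuous_on {p..q} G"
  shows "\<bar>H (cmod (v y)) - H (cmod (v x))\<bar> \<le> integral {x..y} (\<lambda>t. cmod (g t) * \<bar>G (cmod (v t))\<bar>)"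
proof (rule chain_rule_le[OF xy _ range _ _ H G])
  show "continuous_on {x..y} (\<lambda>t. cmod (v t))" by (rule primitive_cmod_continuous[OF v])
  show "(\<lambda>t. cmod (g t)) absolutely_integrable_on {x..y}"
    by (rule set_integrable_norm[OF locally_integrable_Icc[OF primitive_locally_integrable[OF v]]])
qed (auto intro: cmod_primitive_lipschitz[OF v])

text \<open>The chain rule for \<open>s\<^sup>2\<close> and 2 p q \<le> p^2 + q^2. The integrand on
  the right is integrable over the whole line, so far out the squared modulus can hardly
  vary.\<close>

lemma square_increment_le:
  assumes v: "primitive g v" and L: "v \<in> L2" "g \<in> L2" and xy: "x \<le> y"
  shows "\<bar>(cmod (v y))\<^sup>2 - (cmod (v x))\<^sup>2\<bar> \<le> integral {x..y} (\<lambda>t. (cmod (g t))\<^sup>2 + (cmod (v t))\<^sup>2)"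
proof -
  have "compact ((\<lambda>t. cmod (v t)) ` {x..y})"
    by (intro compact_continuous_image primitive_cmod_continuous[OF v]) auto
  then obtain B where B: "\<And>t. t \<in> {x..y} \<Longrightarrow> cmod (v t) \<le> B"
    by (force dest!: compact_imp_bounded simp: bounded_iff)
  have cont: "continuous_on {x..y} (\<lambda>t. 2 * cmod (v t))"
    by (intro continuous_intros primitive_continuous[OF v])
  have i1: "(\<lambda>t. cmod (g t) * \<bar>2 * cmod (v t)\<bar>) integrable_on {x..y}"
    using absolutely_integrable_continuous_mult[OF cont
        set_integrable_norm[OF locally_integrable_Icc[OF primitive_locally_integrable[OF v]]]]
    by (simp add: absolutely_integrable_on_def mult.commute)
  have i2: "(\<lambda>t. (cmod (g t))\<^sup>2 + (cmod (v t))\<^sup>2) integrable_on {x..y}"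
    using L by (intro integrable_add)
      (auto simp: L2_def absolutely_integrable_on_def dest!: integrable_lebesgue_Icc[of _ x y])
  have "\<bar>(cmod (v y))\<^sup>2 - (cmod (v x))\<^sup>2\<bar> \<le> integral {x..y} (\<lambda>t. cmod (g t) * \<bar>2 * cmod (v t)\<bar>)"
    by (rule primitive_chain_rule[OF v xy, of 0 B "\<lambda>s. s\<^sup>2" "\<lambda>s. 2 * s"])
       (use B in \<open>auto intro!: continuous_intros derivative_eq_intros\<close>)
  also have "\<dots> \<le> integral {x..y} (\<lambda>t. (cmod (g t))\<^sup>2 + (cmod (v t))\<^sup>2)"
    by (rule integral_le[OF i1 i2]) (use sum_squares_bound[of "cmod (g _)" "cmod (v _)"] in \<open>auto simp: mult_ac\<close>)
  finally show ?thesis .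
qed

text \<open>A value of at least \<open>e\<close> in the region of small tails would keep the squared
  modulus above \<open>e\<^sup>2 / 2\<close> on arbitrarily long intervals, which exceeds the finite
  mass.\<close>

lemma primitive_L2_vanishes:
  assumes v: "primitive g v" and L: "v \<in> L2" "g \<in> L2" and e: "e > 0"
  obtains R where "\<And>x. \<bar>x\<bar> \<ge> R \<Longrightarrow> cmod (v x) < e"
proof -
  let ?q = "\<lambda>t. (cmod (g t))\<^sup>2 + (cmod (v t))\<^sup>2"
  have e2: "e\<^sup>2 / 2 > 0" using e by simp
  have iq: "integrable lebesgue ?q" using L by (auto simp: L2_def)
  have iv: "integrable lebesgue (\<lambda>t. (cmod (v t))\<^sup>2)" using L by (auto simp: L2_def)
  obtain N where N: "\<And>x y. x \<le> y \<Longrightarrow> N \<le> x \<or> y \<le> - N \<Longrightarrow> integral {x..y} ?q < e\<^sup>2 / 2"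
    by (rule integrable_tail_small[OF iq _ e2]) auto
  have "cmod (v x) < e" if x: "\<bar>x\<bar> \<ge> max N 0" for x
  proof (rule ccontr)
    assume "\<not> cmod (v x) < e"
    then have vx: "(cmod (v x))\<^sup>2 \<ge> e\<^sup>2" using e by (intro power_mono) auto
    obtain n :: nat where n: "real n > (LINT t|lebesgue. (cmod (v t))\<^sup>2) / (e\<^sup>2 / 2)"
      using reals_Archimedean2 by blast
    \<comment> \<open>An interval of length \<open>n\<close> that starts at \<open>x\<close> and
      leads away from the origin, so that the tail bound applies all along it.\<close>
    define l u where "l = (if x \<ge> 0 then x else x - real n)" and "u = l + real n"
    have lower: "(cmod (v t))\<^sup>2 \<ge> e\<^sup>2 / 2" if t: "t \<in> {l..u}" for t
    proof (cases "x \<ge> 0")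
      case True
      then have "integral {x..t} ?q < e\<^sup>2 / 2" using x t by (intro N) (auto simp: l_def u_def)
      then show ?thesis
        using square_increment_le[OF v L, of x t] t True vx unfolding l_def by (auto split: if_splits)
    next
      case False
      then have "integral {t..x} ?q < e\<^sup>2 / 2" using x t by (intro N) (auto simp: l_def u_def)
      then show ?thesis
        using square_increment_le[OF v L, of t x] t False vx unfolding l_def u_def by auto
    qed
    have "real n * (e\<^sup>2 / 2) = integral {l..u} (\<lambda>t. e\<^sup>2 / 2)" by (simp add: u_def)
    also have "\<dots> \<le> integral {l..u} (\<lambda>t. (cmod (v t))\<^sup>2)"
      using integrable_lebesgue_Icc[OF iv, of l u] lower
      by (intro integral_le) (auto simp: absolutely_integrable_on_def)
    also have "\<dots> \<le> (LINT t|lebesgue. (cmod (v t))\<^sup>2)"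
      by (rule integral_Icc_le_LINT[OF iv]) auto
    finally show False using n e2 by (simp add: divide_simps)
  qed
  then show ?thesis by (rule that)
qed

lemma primitive_L2_attains_max:
  assumes v: "primitive g v" and L: "v \<in> L2" "g \<in> L2"
  obtains x0 where "\<And>x. cmod (v x) \<le> cmod (v x0)"
proof (cases "\<forall>x. v x = 0")
  case True
  then show ?thesis using that by simp
next
  case False
  then obtain x1 where x1: "cmod (v x1) > 0" by auto
  obtain R where R: "\<And>x. \<bar>x\<bar> \<ge> R \<Longrightarrow> cmod (v x) < cmod (v x1)"
    using primitive_L2_vanishes[OF v L x1] by blast
  have ne: "x1 \<in> {-R..R}" using R[of x1] by force
  then obtain x0 where x0: "\<And>x. x \<in> {-R..R} \<Longrightarrow> cmod (v x) \<le> cmod (v x0)"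
    using continuous_attains_sup[OF compact_Icc _ primitive_cmod_continuous[OF v], of "-R" R] by blast
  have "cmod (v x) \<le> cmod (v x0)" for x
    using x0[of x] x0[OF ne] R[of x] by (cases "\<bar>x\<bar> \<ge> R") (auto simp: abs_if split: if_splits)
  then show ?thesis by (rule that)
qed

section \<open>The comparison speed and the completed square\<close>

text \<open>The slope of a soliton of height \<open>M\<close> as a function of its value
  \<open>s\<close>: the square of this is the first integral of w'' = d M w - (3/2) d w^2 for
  solutions decaying at infinity.\<close>

definition speed :: "real \<Rightarrow> real \<Rightarrow> real \<Rightarrow> real" where
  "speed d M s = s * sqrt (d * (M - s))"

text \<open>Obtained by the substitution r = sqrt (M - s), which turns s sqrt (M - s) ds into -2 (M
  - r^2) r^2 dr. The first term normalizes the value at 0, since -2/3 + 2/5 = -4/15.\<close>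

definition speed_integral :: "real \<Rightarrow> real \<Rightarrow> real \<Rightarrow> real" where
  "speed_integral d M s = sqrt d * (4/15 * M\<^sup>2 * sqrt M
     - 2/3 * M * sqrt (M - s) ^ 3 + 2/5 * sqrt (M - s) ^ 5)"

lemma speed_continuous: "continuous_on S (speed d M)"
  unfolding speed_def by (intro continuous_intros)

lemma speed_integral_continuous: "continuous_on S (speed_integral d M)"
  unfolding speed_integral_def by (intro continuous_intros)

lemma speed_integral_derivative:
  assumes "s < M" "d > 0"
  shows "(speed_integral d M has_real_derivative speed d M s) (at s)"
proof -
  define r where "r = sqrt (M - s)"
  have r: "r > 0" "s = M - r\<^sup>2" using assms by (auto simp: r_def)
  have R: "((\<lambda>s. sqrt (M - s)) has_real_derivative - 1 / (2 * r)) (at s)"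
    unfolding r_def using assms by (auto intro!: derivative_eq_intros simp: field_simps)
  have "(speed_integral d M has_real_derivative
      sqrt d * (- (2/3 * M * (3 * r\<^sup>2 * (- 1 / (2 * r)))) + 2/5 * (5 * r ^ 4 * (- 1 / (2 * r))))) (at s)"
    unfolding speed_integral_def
    by (rule DERIV_cong, (rule derivative_intros DERIV_power[OF R])+) (simp add: r_def eval_nat_numeral)
  moreover have "sqrt d * (- (2/3 * M * (3 * r\<^sup>2 * (- 1 / (2 * r)))) + 2/5 * (5 * r ^ 4 * (- 1 / (2 * r))))
      = sqrt d * ((M - r\<^sup>2) * r)"
    using r(1) by (simp add: field_simps power2_eq_square eval_nat_numeral)
  moreover have "\<dots> = speed d M s"
    using r(1) unfolding speed_def r(2) by (simp add: real_sqrt_mult)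
  ultimately show ?thesis by simp
qed

lemma speed_integral_0:
  assumes "M \<ge> 0"
  shows "speed_integral d M 0 = 0"
proof -
  define r where "r = sqrt M"
  have "M = r\<^sup>2" using assms by (simp add: r_def)
  then show ?thesis
    unfolding speed_integral_def diff_zero r_def[symmetric]
    by (simp add: eval_nat_numeral)
qed

lemma speed_integral_max: "speed_integral d M M = sqrt d * (4/15 * M\<^sup>2 * sqrt M)"
  by (simp add: speed_integral_def)

lemma speed_nonneg: "0 \<le> s \<Longrightarrow> s \<le> M \<Longrightarrow> d \<ge> 0 \<Longrightarrow> speed d M s \<ge> 0"
  by (simp add: speed_def)

lemma speed_square: "s \<le> M \<Longrightarrow> d \<ge> 0 \<Longrightarrow> (speed d M s)\<^sup>2 = d * M * s\<^sup>2 - d * s ^ 3"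
  by (simp add: speed_def power_mult_distrib) (simp add: algebra_simps power2_eq_square power3_eq_cube)

lemma measurable_lebesgue_continuous:
  fixes f :: "real \<Rightarrow> 'a::topological_space"
  assumes "continuous_on UNIV f"
  shows "f \<in> borel_measurable lebesgue"
  using borel_measurable_continuous_onI[OF assms] by (simp add: measurable_completion)

lemma L2_mult_integrable:
  fixes f g :: "real \<Rightarrow> real"
  assumes "f \<in> borel_measurable lebesgue" "g \<in> borel_measurable lebesgue"
    "integrable lebesgue (\<lambda>x. (f x)\<^sup>2)" "integrable lebesgue (\<lambda>x. (g x)\<^sup>2)"
  shows "integrable lebesgue (\<lambda>x. f x * g x)"
proof (rule Bochner_Integration.integrable_bound)
  show "integrable lebesgue (\<lambda>x. (f x)\<^sup>2 + (g x)\<^sup>2)" using assms by auto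
  have "\<bar>f x * g x\<bar> \<le> (f x)\<^sup>2 + (g x)\<^sup>2" for x
    using sum_squares_bound[of "\<bar>f x\<bar>" "\<bar>g x\<bar>"] mult_nonneg_nonneg[OF abs_ge_zero abs_ge_zero, of "f x" "g x"]
    unfolding abs_mult power2_abs by linarith
  then show "AE x in lebesgue. norm (f x * g x) \<le> norm ((f x)\<^sup>2 + (g x)\<^sup>2)"
    by auto
qed (use assms in auto)

lemma bounded_L2_cube_integrable:
  fixes w :: "real \<Rightarrow> real"
  assumes "w \<in> borel_measurable lebesgue" "integrable lebesgue (\<lambda>x. (w x)\<^sup>2)" "\<And>x. \<bar>w x\<bar> \<le> B"
  shows "integrable lebesgue (\<lambda>x. (w x) ^ 3)"
proof (rule Bochner_Integration.integrable_bound)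
  show "integrable lebesgue (\<lambda>x. B * (w x)\<^sup>2)" using assms by auto
  have "\<bar>(w x) ^ 3\<bar> \<le> B * (w x)\<^sup>2" for x
  proof -
    have "\<bar>(w x) ^ 3\<bar> = \<bar>w x\<bar> * (w x)\<^sup>2" by (simp add: power3_eq_cube power2_eq_square abs_mult)
    also have "\<dots> \<le> B * (w x)\<^sup>2" by (intro mult_right_mono assms) auto
    finally show ?thesis .
  qed
  then show "AE x in lebesgue. norm ((w x) ^ 3) \<le> norm (B * (w x)\<^sup>2)"
    by (metis (no_types, lifting) AE_I2 abs_ge_self order_trans real_norm_def)
qed (use assms in auto)

lemma speed_flux_lower_bound:
  assumes v: "primitive g v" and L: "v \<in> L2" "g \<in> L2" and d: "d > 0"
    and max: "\<And>x. cmod (v x) \<le> M" and x0: "cmod (v x0) = M"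
  shows "integrable lebesgue (\<lambda>x. cmod (g x) * speed d M (cmod (v x)))"
    and "2 * speed_integral d M M \<le> (LINT x|lebesgue. cmod (g x) * speed d M (cmod (v x)))"
proof -
  let ?G = "\<lambda>x. speed d M (cmod (v x))" and ?H = "speed_integral d M"
  have G0: "?G x \<ge> 0" for x using max d by (intro speed_nonneg) auto
  have cG: "continuous_on S ?G" for S
    unfolding speed_def by (intro continuous_intros primitive_continuous[OF v])
  have "integrable lebesgue (\<lambda>x. (?G x)\<^sup>2)"
  proof -
    have "(?G x)\<^sup>2 = d * M * (cmod (v x))\<^sup>2 - d * (cmod (v x)) ^ 3" for x
      using max d by (intro speed_square) auto
    moreover have "integrable lebesgue (\<lambda>x. (cmod (v x)) ^ 3)"
      using L max by (intro bounded_L2_cube_integrable[of _ M]) (auto simp: L2_def)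
    ultimately show ?thesis using L by (auto simp: L2_def)
  qed
  then show int: "integrable lebesgue (\<lambda>x. cmod (g x) * ?G x)"
    using L measurable_lebesgue_continuous[OF cG]
    by (intro L2_mult_integrable) (auto simp: L2_def)
  have chain: "\<bar>?H (cmod (v y)) - ?H (cmod (v x))\<bar> \<le> integral {x..y} (\<lambda>t. cmod (g t) * ?G t)"
    if "x \<le> y" for x y
  proof -
    have "\<bar>?H (cmod (v y)) - ?H (cmod (v x))\<bar> \<le> integral {x..y} (\<lambda>t. cmod (g t) * \<bar>?G t\<bar>)"
      using max d by (intro primitive_chain_rule[OF v that, of 0 M] speed_continuous
          speed_integral_continuous speed_integral_derivative) auto
    then show ?thesis by (simp add: abs_of_nonneg[OF G0])
  qed
  show "2 * ?H M \<le> (LINT x|lebesgue. cmod (g x) * ?G x)"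
  proof (rule field_le_epsilon)
    fix e :: real assume e: "e > 0"
    \<comment> \<open>At a finite distance the modulus is small but need not be 0. By continuity of
      \<open>?H\<close> at 0 each of the two legs loses at most \<open>e / 2\<close>.\<close>
    have "isCont ?H 0" using speed_integral_continuous[of UNIV] by (simp add: continuous_on_eq_continuous_at)
    then have "\<exists>\<delta>>0. \<forall>s. dist s 0 < \<delta> \<longrightarrow> dist (?H s) (?H 0) < e / 2"
      using half_gt_zero[OF e] unfolding continuous_at_eps_delta by blast
    then obtain \<delta> where \<delta>: "\<delta> > 0" "\<And>s. \<bar>s\<bar> < \<delta> \<Longrightarrow> \<bar>?H s\<bar> < e / 2"
      using max[of x0] norm_ge_zero[of "v x0"] x0 by (auto simp: speed_integral_0)
    obtain R where R: "\<And>x. \<bar>x\<bar> \<ge> R \<Longrightarrow> cmod (v x) < \<delta>"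
      using primitive_L2_vanishes[OF v L \<delta>(1)] by blast
    obtain r where r: "\<bar>R\<bar> \<le> r" "\<bar>x0\<bar> \<le> r" using max.cobounded1 max.cobounded2 by blast
    let ?x = "- r" and ?y = r
    have le: "?x \<le> x0" "x0 \<le> ?y" using r by auto
    have "cmod (v ?x) < \<delta>" "cmod (v ?y) < \<delta>" using r by (intro R; simp)+
    then have "\<bar>?H (cmod (v ?x))\<bar> < e / 2" "\<bar>?H (cmod (v ?y))\<bar> < e / 2"
      using \<delta>(2)[of "cmod (v ?x)"] \<delta>(2)[of "cmod (v ?y)"] by simp_all
    moreover have "integral {?x..x0} (\<lambda>t. cmod (g t) * ?G t) + integral {x0..?y} (\<lambda>t. cmod (g t) * ?G t)
        = integral {?x..?y} (\<lambda>t. cmod (g t) * ?G t)"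
      using le integrable_lebesgue_Icc[OF int]
      by (intro Henstock_Kurzweil_Integration.integral_combine) (auto simp: absolutely_integrable_on_def)
    moreover have "\<dots> \<le> (LINT x|lebesgue. cmod (g x) * ?G x)"
      by (rule integral_Icc_le_LINT[OF int]) (auto simp: G0)
    ultimately show "2 * ?H M \<le> (LINT x|lebesgue. cmod (g x) * ?G x) + e"
      using chain[OF le(1), unfolded x0] chain[OF le(2), unfolded x0] by linarith
  qed
qed

lemma energy_completed_square:
  assumes v: "primitive g v" and L: "v \<in> L2" "g \<in> L2" and d: "d > 0"
    and max: "\<And>x. cmod (v x) \<le> M" and x0: "cmod (v x0) = M"
  shows "integrable lebesgue (\<lambda>x. (cmod (g x) - speed d M (cmod (v x)))\<^sup>2)"
    and "1 / 2 * (LINT x|lebesgue. (cmod (g x) - speed d M (cmod (v x)))\<^sup>2)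
      + sqrt d * (8/15 * M\<^sup>2 * sqrt M) - d / 2 * M * (LINT x|lebesgue. (cmod (v x))\<^sup>2)
      \<le> 1 / 2 * (LINT x|lebesgue. (cmod (g x))\<^sup>2) - d / 2 * (LINT x|lebesgue. (cmod (v x)) ^ 3)"
proof -
  let ?G = "\<lambda>x. speed d M (cmod (v x))"
  note flux = speed_flux_lower_bound[OF v L d max x0]
  have i2: "integrable lebesgue (\<lambda>x. (cmod (v x))\<^sup>2)" "integrable lebesgue (\<lambda>x. (cmod (g x))\<^sup>2)"
    using L by (auto simp: L2_def)
  have i3: "integrable lebesgue (\<lambda>x. (cmod (v x)) ^ 3)"
    using L max by (intro bounded_L2_cube_integrable[of _ M]) (auto simp: L2_def)
  have expand: "(cmod (g x) - ?G x)\<^sup>2 = (cmod (g x))\<^sup>2 + (d * M * (cmod (v x))\<^sup>2 - d * (cmod (v x)) ^ 3)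
      - 2 * (cmod (g x) * ?G x)" for x
    using speed_square[OF max less_imp_le[OF d], of x] by (simp add: power2_diff)
  show "integrable lebesgue (\<lambda>x. (cmod (g x) - ?G x)\<^sup>2)"
    unfolding expand using i2 i3 flux(1) by auto
  have "(LINT x|lebesgue. (cmod (g x) - ?G x)\<^sup>2) = (LINT x|lebesgue. (cmod (g x))\<^sup>2)
     + (d * M * (LINT x|lebesgue. (cmod (v x))\<^sup>2) - d * (LINT x|lebesgue. (cmod (v x)) ^ 3))
     - 2 * (LINT x|lebesgue. cmod (g x) * ?G x)"
    unfolding expand using i2 i3 flux(1) by simp
  then show "1 / 2 * (LINT x|lebesgue. (cmod (g x) - ?G x)\<^sup>2)
      + sqrt d * (8/15 * M\<^sup>2 * sqrt M) - d / 2 * M * (LINT x|lebesgue. (cmod (v x))\<^sup>2)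
      \<le> 1 / 2 * (LINT x|lebesgue. (cmod (g x))\<^sup>2) - d / 2 * (LINT x|lebesgue. (cmod (v x)) ^ 3)"
    using flux(2) unfolding speed_integral_max by (simp add: field_simps)
qed

section \<open>The one-variable problem for the height\<close>

text \<open>With m = sqrt M and n = sqrt a, the left-hand side is the excess of the reduced energy
  over the energy of the soliton, up to a positive factor. The double root reflects that the soliton
  height is a critical point; the cofactor has only positive coefficients.\<close>

lemma quintic_identity:
  fixes m n :: real
  shows "2 * m ^ 5 - 5 * n ^ 3 * m\<^sup>2 + 3 * n ^ 5 = (m - n)\<^sup>2 * (2 * m ^ 3 + 4 * m\<^sup>2 * n + 6 * m * n\<^sup>2 + 3 * n ^ 3)"
  by (simp add: algebra_simps power2_eq_square power3_eq_cube eval_nat_numeral)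

text \<open>\<open>4 * a\<^sup>2 / (3 * k)\<close> and \<open>- (8/5) * a\<^sup>2 * k\<close> are
  the mass and the scalar energy of the profile of height \<open>a\<close>, as
  \<open>profile_mass\<close> and \<open>profile_scalar_energy\<close> confirm.\<close>

lemma reduced_energy:
  fixes a k M :: real
  assumes a: "a > 0" and k: "k > 0" and M: "M \<ge> 0"
  defines "d \<equiv> 4 * k\<^sup>2 / a"
  defines "f \<equiv> sqrt d * (8/15 * M\<^sup>2 * sqrt M) - d / 2 * M * (4 * a\<^sup>2 / (3 * k))"
  shows "f \<ge> - (8/5) * a\<^sup>2 * k" and "f = - (8/5) * a\<^sup>2 * k \<Longrightarrow> M = a"
proof -
  define m n where "m = sqrt M" and "n = sqrt a"
  have mn: "M = m\<^sup>2" "a = n\<^sup>2" "m \<ge> 0" "n > 0" using a M by (auto simp: m_def n_def)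
  have sd: "sqrt d = 2 * k / n"
  proof -
    have "d = (2 * k / n)\<^sup>2" unfolding d_def mn by (simp add: power_mult_distrib power_divide)
    then show ?thesis using k mn by simp
  qed
  have sM: "sqrt M = m" by (simp add: m_def)
  have "f - - (8/5) * a\<^sup>2 * k = 8 * k / (15 * n) * (2 * m ^ 5 - 5 * n ^ 3 * m\<^sup>2 + 3 * n ^ 5)"
    unfolding f_def unfolding sd sM unfolding d_def unfolding mn using mn(4) k
    by (simp add: field_simps power2_eq_square power3_eq_cube eval_nat_numeral)
  then have diff: "f - - (8/5) * a\<^sup>2 * k =
      8 * k / (15 * n) * ((m - n)\<^sup>2 * (2 * m ^ 3 + 4 * m\<^sup>2 * n + 6 * m * n\<^sup>2 + 3 * n ^ 3))"
    unfolding quintic_identity .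
  have pos: "2 * m ^ 3 + 4 * m\<^sup>2 * n + 6 * m * n\<^sup>2 + 3 * n ^ 3 > 0"
    using mn by (intro add_nonneg_pos add_nonneg_nonneg) auto
  have "0 \<le> 8 * k / (15 * n) * ((m - n)\<^sup>2 * (2 * m ^ 3 + 4 * m\<^sup>2 * n + 6 * m * n\<^sup>2 + 3 * n ^ 3))"
    using pos k mn by (intro mult_nonneg_nonneg) auto
  with diff show "f \<ge> - (8/5) * a\<^sup>2 * k" by linarith
  assume "f = - (8/5) * a\<^sup>2 * k"
  with diff have "8 * k / (15 * n) * ((m - n)\<^sup>2 * (2 * m ^ 3 + 4 * m\<^sup>2 * n + 6 * m * n\<^sup>2 + 3 * n ^ 3)) = 0"
    by simp
  then have "m = n" using k mn pos by auto
  then show "M = a" using mn by simp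
qed

section \<open>The soliton profile\<close>

text \<open>The soliton has \<open>a = 3 \<omega> / (\<alpha> + \<beta>)\<close> and \<open>k\<^sup>2 = \<omega> / 2\<close>, so that \<open>\<alpha> + \<beta> = 6 k\<^sup>2 / a\<close> and the
  constant \<open>d\<close> of \<^const>\<open>speed\<close> is \<open>4 k\<^sup>2 / a\<close>.\<close>

definition profile :: "real \<Rightarrow> real \<Rightarrow> real \<Rightarrow> real" where
  "profile a k x = a * (sech (k * x))\<^sup>2"

lemma sech_squared: "(sech x)\<^sup>2 = 1 - (tanh x)\<^sup>2"
  using hyperbolic_pythagoras[of x]
  by (simp add: sech_def tanh_def power_divide divide_simps)

lemma profile_tanh: "profile a k x = a * (1 - (tanh (k * x))\<^sup>2)"
  by (simp add: profile_def sech_squared)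

lemma profile_0 [simp]: "profile a k 0 = a"
  by (simp add: profile_tanh)

lemma profile_minus [simp]: "profile a k (- x) = profile a k x"
  by (simp add: profile_tanh)

lemma profile_pos: "a > 0 \<Longrightarrow> profile a k x > 0"
  by (simp add: profile_def sech_def)

lemma profile_le: "a > 0 \<Longrightarrow> profile a k x \<le> a"
  by (simp add: profile_tanh)

lemma profile_less: "a > 0 \<Longrightarrow> k > 0 \<Longrightarrow> x \<noteq> 0 \<Longrightarrow> profile a k x < a"
  by (simp add: profile_tanh)

lemma profile_continuous: "continuous_on S (\<lambda>x. profile a k (x + y))"
  unfolding profile_tanh by (intro continuous_intros) auto

lemma tanh_chain_derivative:
  "((\<lambda>x. tanh (k * (x + y))) has_real_derivative k * (1 - (tanh (k * (x + y)))\<^sup>2)) (at x)"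
  by (auto intro!: derivative_eq_intros)

lemma profile_derivative:
  "((\<lambda>x. profile a k (x + y)) has_real_derivative
     - 2 * k * tanh (k * (x + y)) * profile a k (x + y)) (at x)"
  unfolding profile_tanh
  by (rule DERIV_cong, (rule derivative_intros DERIV_power[OF tanh_chain_derivative])+)
     (simp add: algebra_simps)

text \<open>The right-hand side is the modulus of the derivative of the profile, so the profile
  moves exactly with the comparison speed and the completed square vanishes on it.\<close>

lemma profile_speed:
  assumes "a > 0" "k > 0"
  shows "speed (4 * k\<^sup>2 / a) a (profile a k x) = 2 * k * \<bar>tanh (k * x)\<bar> * profile a k x"
proof -
  have "4 * k\<^sup>2 / a * (a - profile a k x) = (2 * k * tanh (k * x))\<^sup>2"
    using assms by (simp add: profile_tanh field_simps power2_eq_square)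
  then show ?thesis using assms by (simp add: speed_def abs_mult mult_ac)
qed

section \<open>Mass and energy integrals of the profile\<close>

lemma
  fixes F f :: "real \<Rightarrow> real"
  assumes D: "\<And>x. (F has_real_derivative f x) (at x)" and f: "continuous_on UNIV f" "\<And>x. f x \<ge> 0"
    and lim: "(F \<longlongrightarrow> A) at_bot" "(F \<longlongrightarrow> B) at_top"
  shows integrable_FTC_UNIV: "integrable lebesgue f"
    and integral_FTC_UNIV: "(LINT x|lebesgue. f x) = B - A"
proof -
  have meas: "f \<in> borel_measurable lborel" using borel_measurable_continuous_onI[OF f(1)] by simp
  have "((F \<circ> real_of_ereal) \<longlongrightarrow> A) (at_right (- \<infinity>))" "((F \<circ> real_of_ereal) \<longlongrightarrow> B) (at_left \<infinity>)"
    using lim by (auto simp: ereal_tendsto_simps)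
  note FTC = interval_integral_FTC_nonneg[OF _ D _ _ this]
  have "set_integrable lborel (einterval (- \<infinity>) \<infinity>) f" "(LBINT x=- \<infinity>..\<infinity>. f x) = B - A"
    using f by (intro FTC; auto simp: continuous_on_eq_continuous_at)+
  then have "integrable lborel f" "(LINT x|lborel. f x) = B - A"
    by (auto simp: set_integrable_def interval_lebesgue_integral_def set_lebesgue_integral_def)
  then show "integrable lebesgue f" "(LINT x|lebesgue. f x) = B - A"
    using meas by (auto simp: integrable_completion integral_completion)
qed

lemma tanh_shift_limits:
  fixes k y :: real
  assumes "k > 0"
  shows "((\<lambda>x. tanh (k * (x + y))) \<longlongrightarrow> 1) at_top" "((\<lambda>x. tanh (k * (x + y))) \<longlongrightarrow> - 1) at_bot"
proof -
  have top: "((\<lambda>x. tanh (k * (x + y))) \<longlongrightarrow> 1) at_top" for y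
  proof -
    have "filterlim (\<lambda>x. k * (y + x)) at_top at_top"
      by (intro filterlim_tendsto_pos_mult_at_top[OF tendsto_const assms]
          filterlim_tendsto_add_at_top[OF tendsto_const] filterlim_ident)
    then show ?thesis
      by (intro filterlim_compose[OF tanh_real_at_top]) (simp add: add.commute)
  qed
  then show "((\<lambda>x. tanh (k * (x + y))) \<longlongrightarrow> 1) at_top" .
  have "((\<lambda>x. - tanh (k * (x + - y))) \<longlongrightarrow> - 1) at_top"
    by (intro tendsto_minus top)
  moreover have "- tanh (k * (x + - y)) = tanh (k * (- x + y))" for x
    by (simp flip: tanh_minus add: algebra_simps)
  ultimately show "((\<lambda>x. tanh (k * (x + y))) \<longlongrightarrow> - 1) at_bot"
    by (simp add: filterlim_at_bot_mirror)
qed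

lemma
  assumes a: "a > 0" and k: "k > 0"
  shows profile_square_integrable: "integrable lebesgue (\<lambda>x. (profile a k (x + y))\<^sup>2)"
    and profile_square_integral: "(LINT x|lebesgue. (profile a k (x + y))\<^sup>2) = 4 * a\<^sup>2 / (3 * k)"
proof -
  let ?t = "\<lambda>x. tanh (k * (x + y))"
  \<comment> \<open>Substituting t = tanh (k (x + y)), dt = k (1 - t^2) dx leaves the polynomial a^2
    (1 - t^2) / k to be integrated from -1 to 1.\<close>
  let ?F = "\<lambda>x. a\<^sup>2 / k * (?t x - ?t x ^ 3 / 3)"
  have D: "(?F has_real_derivative (profile a k (x + y))\<^sup>2) (at x)" for x
  proof -
    have "((\<lambda>t. a\<^sup>2 / k * (t - t ^ 3 / 3)) has_real_derivative a\<^sup>2 / k * (1 - t\<^sup>2)) (at t)" for t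
      using k by (auto intro!: derivative_eq_intros)
    then show ?thesis
      unfolding profile_tanh
      by (rule DERIV_cong[OF DERIV_chain2[OF _ tanh_chain_derivative]])
         (use k in \<open>simp add: power2_eq_square\<close>)
  qed
  have lim: "(?F \<longlongrightarrow> a\<^sup>2 / k * (- 1 - (- 1) ^ 3 / 3)) at_bot" "(?F \<longlongrightarrow> a\<^sup>2 / k * (1 - 1 ^ 3 / 3)) at_top"
    by (intro tendsto_intros tanh_shift_limits[OF k]; (use k in simp))+
  note FTC = integrable_FTC_UNIV[OF D _ _ lim] integral_FTC_UNIV[OF D _ _ lim]
  show "integrable lebesgue (\<lambda>x. (profile a k (x + y))\<^sup>2)"
    by (rule FTC(1)) (auto intro!: continuous_intros profile_continuous)
  have "(LINT x|lebesgue. (profile a k (x + y))\<^sup>2) = a\<^sup>2 / k * (1 - 1 ^ 3 / 3) - a\<^sup>2 / k * (- 1 - (- 1) ^ 3 / 3)"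
    by (rule FTC(2)) (auto intro!: continuous_intros profile_continuous)
  then show "(LINT x|lebesgue. (profile a k (x + y))\<^sup>2) = 4 * a\<^sup>2 / (3 * k)"
    by (simp add: field_simps)
qed

lemma
  assumes a: "a > 0" and k: "k > 0"
  defines "\<psi>' \<equiv> \<lambda>x y. - 2 * k * tanh (k * (x + y)) * profile a k (x + y)"
  shows profile_derivative_square_integrable: "integrable lebesgue (\<lambda>x. (\<psi>' x y)\<^sup>2)"
    and profile_derivative_square_integral: "(LINT x|lebesgue. (\<psi>' x y)\<^sup>2) = 16 / 15 * a\<^sup>2 * k"
proof -
  let ?t = "\<lambda>x. tanh (k * (x + y))"
  \<comment> \<open>The same substitution, now with the polynomial 4 a^2 k (t^2 - t^4).\<close>
  let ?F = "\<lambda>x. 4 * a\<^sup>2 * k * (?t x ^ 3 / 3 - ?t x ^ 5 / 5)"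
  have D: "(?F has_real_derivative (\<psi>' x y)\<^sup>2) (at x)" for x
  proof -
    have "((\<lambda>t. 4 * a\<^sup>2 * k * (t ^ 3 / 3 - t ^ 5 / 5)) has_real_derivative 4 * a\<^sup>2 * k * (t\<^sup>2 - t ^ 4)) (at t)" for t
      by (auto intro!: derivative_eq_intros)
    then show ?thesis
      unfolding profile_tanh \<psi>'_def
      by (rule DERIV_cong[OF DERIV_chain2[OF _ tanh_chain_derivative]])
         (simp add: algebra_simps power2_eq_square eval_nat_numeral)
  qed
  have lim: "(?F \<longlongrightarrow> 4 * a\<^sup>2 * k * ((- 1) ^ 3 / 3 - (- 1) ^ 5 / 5)) at_bot"
    "(?F \<longlongrightarrow> 4 * a\<^sup>2 * k * (1 ^ 3 / 3 - 1 ^ 5 / 5)) at_top"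
    by (intro tendsto_intros tanh_shift_limits[OF k]; (use k in simp))+
  have cont: "continuous_on UNIV (\<lambda>x. (\<psi>' x y)\<^sup>2)"
    unfolding \<psi>'_def by (intro continuous_intros profile_continuous) auto
  note FTC = integrable_FTC_UNIV[OF D cont _ lim] integral_FTC_UNIV[OF D cont _ lim]
  show "integrable lebesgue (\<lambda>x. (\<psi>' x y)\<^sup>2)" by (rule FTC(1)) auto
  have "(LINT x|lebesgue. (\<psi>' x y)\<^sup>2) = 4 * a\<^sup>2 * k * (1 ^ 3 / 3 - 1 ^ 5 / 5) - 4 * a\<^sup>2 * k * ((- 1) ^ 3 / 3 - (- 1) ^ 5 / 5)"
    by (rule FTC(2)) auto
  then show "(LINT x|lebesgue. (\<psi>' x y)\<^sup>2) = 16 / 15 * a\<^sup>2 * k"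
    by (simp add: field_simps)
qed

text \<open>The first integral expresses the cube through the square and the squared derivative,
  whose integrals are known. The factor on the left is the one in front of the cubic term of the
  energy.\<close>

lemma profile_cube_integral:
  assumes a: "a > 0" and k: "k > 0"
  shows "2 * k\<^sup>2 / a * (LINT x|lebesgue. (profile a k (x + y)) ^ 3) = 32 / 15 * a\<^sup>2 * k"
proof -
  let ?\<psi>' = "\<lambda>x. - 2 * k * tanh (k * (x + y)) * profile a k (x + y)"
  have "4 * k\<^sup>2 / a * (profile a k (x + y)) ^ 3 = 4 * k\<^sup>2 * (profile a k (x + y))\<^sup>2 - (?\<psi>' x)\<^sup>2" for x
    using a by (simp add: profile_tanh field_simps power2_eq_square power3_eq_cube)
  then have "(LINT x|lebesgue. 4 * k\<^sup>2 / a * (profile a k (x + y)) ^ 3) =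
      (LINT x|lebesgue. 4 * k\<^sup>2 * (profile a k (x + y))\<^sup>2 - (?\<psi>' x)\<^sup>2)" by simp
  also have "\<dots> = 4 * k\<^sup>2 * (4 * a\<^sup>2 / (3 * k)) - 16 / 15 * a\<^sup>2 * k"
    using profile_square_integrable[OF a k] profile_derivative_square_integrable[OF a k]
    by (subst Bochner_Integration.integral_diff)
       (auto simp: profile_square_integral[OF a k] profile_derivative_square_integral[OF a k, simplified])
  finally have "4 * k\<^sup>2 / a * (LINT x|lebesgue. (profile a k (x + y)) ^ 3) = 64 / 15 * a\<^sup>2 * k"
    using k by (simp add: field_simps power2_eq_square)
  then show "2 * k\<^sup>2 / a * (LINT x|lebesgue. (profile a k (x + y)) ^ 3) = 32 / 15 * a\<^sup>2 * k"
    by simp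
qed

section \<open>Comparison with the profile\<close>

lemma tanh_artanh_nonneg:
  fixes x :: real
  assumes "0 \<le> x" "x < 1"
  shows "tanh (artanh x) = x"
proof -
  have "exp (- 2 * artanh x) = (1 - x) / (1 + x)"
    using assms by (simp add: artanh_def exp_minus)
  moreover have "(1 - (1 - x) / (1 + x)) / (1 + (1 - x) / (1 + x)) = x"
    using assms by (simp add: field_simps)
  ultimately show ?thesis by (simp add: tanh_real_altdef)
qed

lemma artanh_sqrt_derivative:
  assumes "0 < s" "s < a"
  shows "((\<lambda>s. artanh (sqrt (1 - s / a))) has_real_derivative - 1 / (2 * s * sqrt (1 - s / a))) (at s)"
proof -
  have r: "0 < 1 - s / a" "1 - s / a < 1" using assms by auto
  then have *: "0 < sqrt (1 - s / a)" "sqrt (1 - s / a) < 1" by auto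
  show ?thesis
    by (rule DERIV_cong[OF DERIV_chain2[OF artanh_real_has_field_derivative]])
       (use * r assms in \<open>auto intro!: derivative_eq_intros simp: field_simps\<close>)
qed

text \<open>Along the soliton \<open>artanh (sqrt (1 - w / a))\<close> grows at the constant rate \<open>k\<close>.\<close>

lemma artanh_increment_le:
  fixes w :: "real \<Rightarrow> real"
  assumes a: "a > 0" and k: "k > 0" and w: "continuous_on UNIV w"
    and lip: "\<And>x y. x \<le> y \<Longrightarrow> \<bar>w y - w x\<bar> \<le> integral {x..y} (\<lambda>t. speed (4 * k\<^sup>2 / a) a (w t))"
    and yx: "y \<le> x" and range: "\<And>t. t \<in> {y..x} \<Longrightarrow> 0 < w t \<and> w t < a"
    and w_range: "\<And>x. 0 \<le> w x" "\<And>x. w x \<le> a"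
  shows "artanh (sqrt (1 - w x / a)) \<le> artanh (sqrt (1 - w y / a)) + k * (x - y)"
proof -
  let ?d = "4 * k\<^sup>2 / a"
  let ?T = "\<lambda>s. artanh (sqrt (1 - s / a))" and ?T' = "\<lambda>s. - 1 / (2 * s * sqrt (1 - s / a))"
  have cw: "continuous_on {y..x} w" using w by (rule continuous_on_subset) auto
  \<comment> \<open>The derivative of \<open>?T\<close> is singular at both 0 and \<open>a\<close>.
    The attained extrema confine \<open>w\<close> to a compact part of the open range.\<close>
  obtain p where p: "p \<in> {y..x}" "\<And>t. t \<in> {y..x} \<Longrightarrow> w p \<le> w t"
    using continuous_attains_inf[OF compact_Icc _ cw] yx by (auto simp: Ball_def)
  obtain q where q: "q \<in> {y..x}" "\<And>t. t \<in> {y..x} \<Longrightarrow> w t \<le> w q"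
    using continuous_attains_sup[OF compact_Icc _ cw] yx by (auto simp: Ball_def)
  have pq: "0 < w p" "w q < a" using range p q by auto
  have DT: "(?T has_real_derivative ?T' s) (at s)" if "s \<in> {w p..w q}" for s
    using that pq by (intro artanh_sqrt_derivative) auto
  have "\<bar>?T (w x) - ?T (w y)\<bar> \<le> integral {y..x} (\<lambda>t. speed ?d a (w t) * \<bar>?T' (w t)\<bar>)"
  proof (rule chain_rule_le[OF yx cw])
    show "w ` {y..x} \<subseteq> {w p..w q}" using p q by auto
    have "continuous_on {y..x} (\<lambda>t. speed ?d a (w t))"
      unfolding speed_def by (intro continuous_intros cw)
    then show "(\<lambda>t. speed ?d a (w t)) absolutely_integrable_on {y..x}"
      by (rule absolutely_integrable_continuous_real)
    show "continuous_on {w p..w q} ?T"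
      using DT by (meson DERIV_isCont continuous_at_imp_continuous_on)
    show "(?T has_real_derivative ?T' s) (at s)" if "w p < s" "s < w q" for s
      using DT that by auto
    show "continuous_on {w p..w q} ?T'"
      using pq a by (intro continuous_intros) auto
    show "0 \<le> speed ?d a (w t)" for t using w_range a by (intro speed_nonneg) auto
  qed (use lip in auto)
  \<comment> \<open>With r = sqrt (1 - w / a) the speed is 2 k w r and the derivative of
    \<open>?T\<close> has modulus 1 / (2 w r); everything but k cancels.\<close>
  also have "\<dots> = integral {y..x} (\<lambda>t. k)"
  proof (rule integral_cong)
    fix t assume t: "t \<in> {y..x}"
    define r where "r = sqrt (1 - w t / a)"
    have r: "r > 0" using range[OF t] a by (auto simp: r_def)
    have "?d * (a - w t) = (2 * k)\<^sup>2 * (1 - w t / a)" using a by (simp add: field_simps power2_eq_square)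
    then have "sqrt (?d * (a - w t)) = 2 * k * r"
      using k by (simp only: real_sqrt_mult r_def real_sqrt_abs)
    then show "speed ?d a (w t) * \<bar>?T' (w t)\<bar> = k"
      unfolding speed_def r_def[symmetric] using range[OF t] r by (simp add: abs_mult)
  qed
  also have "\<dots> = k * (x - y)" using yx by simp
  finally show ?thesis by linarith
qed

text \<open>Along the profile the transformed height is exactly \<open>k * (x - x0)\<close> to the
  right of the centre, while for \<open>w\<close> it grows at most at rate \<open>k\<close>. As the
  transformation is decreasing, \<open>w\<close> falls no faster than the profile.\<close>

lemma profile_comparison_positive:
  fixes w :: "real \<Rightarrow> real"
  assumes a: "a > 0" and k: "k > 0" and w: "continuous_on UNIV w"
    and lip: "\<And>x y. x \<le> y \<Longrightarrow> \<bar>w y - w x\<bar> \<le> integral {x..y} (\<lambda>t. speed (4 * k\<^sup>2 / a) a (w t))"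
    and w_range: "\<And>x. 0 \<le> w x" "\<And>x. w x \<le> a"
    and start: "w x0 = a" and x: "x0 \<le> x" and pos: "\<And>t. x0 \<le> t \<Longrightarrow> t \<le> x \<Longrightarrow> 0 < w t"
  shows "profile a k (x - x0) \<le> w x"
proof (cases "w x = a")
  case True
  then show ?thesis using profile_le[OF a] by simp
next
  case False
  let ?T = "\<lambda>t. artanh (sqrt (1 - w t / a))"
  define Z where "Z = {x0..x} \<inter> {t. w t = a}"
  have "compact Z"
    using compact_Int_closed[OF compact_Icc closed_Collect_eq[OF w continuous_on_const], of x0 x a]
    by (simp add: Z_def)
  moreover have "x0 \<in> Z" using start x by (auto simp: Z_def)
  ultimately obtain z where z: "z \<in> Z" "\<And>t. t \<in> Z \<Longrightarrow> t \<le> z"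
    using compact_attains_sup[of Z] by blast
  have zx: "x0 \<le> z" "z < x" "w z = a" using z(1) False by (auto simp: Z_def less_le)
  have below: "0 < w t \<and> w t < a" if "z < t" "t \<le> x" for t
    using z(2)[of t] that zx pos[of t] w_range(2)[of t] by (force simp: Z_def less_le)
  have step: "?T x \<le> ?T t + k * (x - t)" if "z < t" "t \<le> x" for t
    using that by (intro artanh_increment_le[OF a k w lip _ _ w_range] below) auto
  have cont: "isCont (\<lambda>t. ?T t + k * (x - t)) z"
  proof -
    have "isCont w z" using w by (simp add: continuous_on_eq_continuous_at)
    then show ?thesis using zx a by (intro continuous_intros) auto
  qed
  have "?T x \<le> ?T z + k * (x - z)"
  proof (rule tendsto_lowerbound)
    show "((\<lambda>t. ?T t + k * (x - t)) \<longlongrightarrow> ?T z + k * (x - z)) (at_right z)"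
      using cont unfolding isCont_def by (rule filterlim_mono) (auto simp: at_le)
    show "eventually (\<lambda>t. ?T x \<le> ?T t + k * (x - t)) (at_right z)"
      using eventually_at_right_real[OF zx(2)] by eventually_elim (use step in auto)
  qed auto
  then have T: "?T x \<le> k * (x - x0)"
  proof -
    have "k * (x - z) \<le> k * (x - x0)" using zx k by (intro mult_left_mono) auto
    then show ?thesis using \<open>?T x \<le> ?T z + k * (x - z)\<close> zx a by simp
  qed
  let ?r = "sqrt (1 - w x / a)"
  have r: "0 \<le> ?r" "?r < 1" "0 \<le> 1 - w x / a" using pos[of x] w_range(2)[of x] x a by auto
  have "?r = tanh (?T x)" using r by (simp add: tanh_artanh_nonneg)
  also have "\<dots> \<le> tanh (k * (x - x0))" using T by simp
  finally have "?r\<^sup>2 \<le> (tanh (k * (x - x0)))\<^sup>2" using r by (intro power_mono) auto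
  then have "1 - w x / a \<le> (tanh (k * (x - x0)))\<^sup>2" using r by simp
  then show ?thesis using a by (simp add: profile_tanh field_simps)
qed

text \<open>Positivity comes for free: up to its first zero the function dominates the profile.\<close>

lemma profile_comparison_right:
  fixes w :: "real \<Rightarrow> real"
  assumes a: "a > 0" and k: "k > 0" and w: "continuous_on UNIV w"
    and lip: "\<And>x y. x \<le> y \<Longrightarrow> \<bar>w y - w x\<bar> \<le> integral {x..y} (\<lambda>t. speed (4 * k\<^sup>2 / a) a (w t))"
    and w_range: "\<And>x. 0 \<le> w x" "\<And>x. w x \<le> a"
    and start: "w x0 = a" and x: "x0 \<le> x"
  shows "profile a k (x - x0) \<le> w x"
proof (rule profile_comparison_positive[OF a k w lip w_range start x])
  fix t assume t: "x0 \<le> t" "t \<le> x"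
  show "0 < w t"
  proof (rule ccontr)
    assume "\<not> 0 < w t"
    define Z where "Z = {x0..x} \<inter> {t. w t = 0}"
    have "compact Z"
      using compact_Int_closed[OF compact_Icc closed_Collect_eq[OF w continuous_on_const], of x0 x 0]
      by (simp add: Z_def)
    moreover have "t \<in> Z" using t \<open>\<not> 0 < w t\<close> w_range(1)[of t] by (auto simp: Z_def)
    ultimately obtain z where z: "z \<in> Z" "\<And>t. t \<in> Z \<Longrightarrow> z \<le> t"
      using compact_attains_inf[of Z] by blast
    have zx: "x0 < z" "z \<le> x" "w z = 0" using z(1) start a by (auto simp: Z_def less_le)
    have "profile a k (s - x0) \<le> w s" if s: "x0 \<le> s" "s < z" for s
    proof (rule profile_comparison_positive[OF a k w lip w_range start s(1)])
      fix r assume "x0 \<le> r" "r \<le> s"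
      then show "0 < w r" using z(2)[of r] s zx w_range(1)[of r] by (force simp: Z_def less_le)
    qed
    then have ev: "eventually (\<lambda>s. 0 \<le> w s - profile a k (s - x0)) (at_left z)"
      using eventually_at_left_real[OF zx(1)] by (auto elim!: eventually_mono)
    have "continuous_on UNIV (\<lambda>s. w s - profile a k (s - x0))"
      using profile_continuous[of UNIV a k "- x0"] by (intro continuous_intros w) simp
    then have "isCont (\<lambda>s. w s - profile a k (s - x0)) z" by (simp add: continuous_on_eq_continuous_at)
    then have "((\<lambda>s. w s - profile a k (s - x0)) \<longlongrightarrow> w z - profile a k (z - x0)) (at_left z)"
      unfolding isCont_def by (rule filterlim_mono) (auto simp: at_le)
    then have "0 \<le> w z - profile a k (z - x0)"
      by (rule tendsto_lowerbound) (use ev in auto)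
    then show False using profile_pos[OF a, of k "z - x0"] zx by simp
  qed
qed

lemma profile_comparison:
  fixes w :: "real \<Rightarrow> real"
  assumes a: "a > 0" and k: "k > 0" and w: "continuous_on UNIV w"
    and lip: "\<And>x y. x \<le> y \<Longrightarrow> \<bar>w y - w x\<bar> \<le> integral {x..y} (\<lambda>t. speed (4 * k\<^sup>2 / a) a (w t))"
    and w_range: "\<And>x. 0 \<le> w x" "\<And>x. w x \<le> a"
    and start: "w x0 = a"
  shows "profile a k (x - x0) \<le> w x"
proof (cases "x0 \<le> x")
  case True
  show ?thesis by (rule profile_comparison_right[OF a k w lip w_range start True])
next
  case False
  let ?w = "\<lambda>t. w (- t)"
  have "profile a k (- x - - x0) \<le> ?w (- x)"
  proof (rule profile_comparison_right[OF a k])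
    show "continuous_on UNIV ?w" using w by (intro continuous_on_compose2[OF w]) (auto intro: continuous_intros)
    fix s t :: real assume "s \<le> t"
    then have "\<bar>w (- s) - w (- t)\<bar> \<le> integral {- t..- s} (\<lambda>t. speed (4 * k\<^sup>2 / a) a (w t))"
      by (intro lip) auto
    also have "\<dots> = integral {s..t} (\<lambda>t. speed (4 * k\<^sup>2 / a) a (?w t))"
      using Henstock_Kurzweil_Integration.integral_reflect_real[of t s "\<lambda>r. speed (4 * k\<^sup>2 / a) a (?w r)"] by simp
    finally show "\<bar>?w t - ?w s\<bar> \<le> integral {s..t} (\<lambda>t. speed (4 * k\<^sup>2 / a) a (?w t))"
      by (simp add: abs_minus_commute)
  qed (use w_range start False in auto)
  then show ?thesis using profile_minus[of a k "x - x0"] by simp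
qed

section \<open>Equality in the scalar inequality\<close>

lemma AE_eq_continuous_imp_eq:
  fixes f h :: "real \<Rightarrow> real"
  assumes "AE x in lebesgue. f x = h x" "continuous_on UNIV f" "continuous_on UNIV h"
  shows "f x = h x"
  using mem_closed_if_AE_lebesgue[OF closed_Collect_eq[OF assms(2,3)], of x] assms(1) by simp

lemma integral_AE_eq:
  fixes f h :: "real \<Rightarrow> real"
  assumes "AE x in lebesgue. f x = h x"
  shows "integral {a..b} f = integral {a..b} h"
proof (rule integral_spike[of "{x. f x \<noteq> h x}"])
  show "negligible {x. f x \<noteq> h x}"
    using assms by (simp add: completion.AE_iff_null_sets negligible_iff_null_sets)
qed auto

text \<open>The case of equality in the triangle inequality. It serves to show that a path whose
  length is just the gain in modulus runs along a ray, that is, keeps its phase.\<close>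

lemma norm_diff_eq_imp_parallel:
  fixes x y :: "'a::real_inner"
  assumes "norm (y - x) \<le> norm y - norm x"
  shows "norm y *\<^sub>R x = norm x *\<^sub>R y"
proof -
  have "norm (x + (y - x)) = norm x + norm (y - x)"
    using assms norm_triangle_ineq[of x "y - x"] by simp
  then have "norm x *\<^sub>R (y - x) = norm (y - x) *\<^sub>R x"
    by (simp only: norm_triangle_eq)
  moreover have "norm (y - x) = norm y - norm x"
    using assms norm_triangle_ineq2[of y x] by simp
  ultimately show ?thesis by (simp add: algebra_simps)
qed

text \<open>On each side of its centre the profile is monotone, so integrating its speed gives the
  drop in height with equality. The sign of tanh forces the two cases.\<close>

lemma integral_speed_profile:
  assumes a: "a > 0" and k: "k > 0"
  shows "0 \<le> x \<Longrightarrow> integral {x0..x0 + x} (\<lambda>t. speed (4 * k\<^sup>2 / a) a (profile a k (t + - x0))) = a - profile a k x"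
    and "x \<le> 0 \<Longrightarrow> integral {x0 + x..x0} (\<lambda>t. speed (4 * k\<^sup>2 / a) a (profile a k (t + - x0))) = a - profile a k x"
proof -
  let ?p = "\<lambda>t. profile a k (t + - x0)" and ?S = "\<lambda>t. speed (4 * k\<^sup>2 / a) a (profile a k (t + - x0))"
  have p': "(?p has_vector_derivative - 2 * k * tanh (k * (t + - x0)) * ?p t) (at t within S)" for t S
    using profile_derivative[of a k "- x0" t]
    by (simp add: has_real_derivative_iff_has_vector_derivative has_vector_derivative_at_within)
  show "integral {x0..x0 + x} ?S = a - profile a k x" if "0 \<le> x"
  proof (rule integral_unique)
    have "(?S has_integral - ?p (x0 + x) - - ?p x0) {x0..x0 + x}"
    proof (rule fundamental_theorem_of_calculus)
      fix t assume "t \<in> {x0..x0 + x}"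
      then have "0 \<le> tanh (k * (t + - x0))" using k by simp
      then have "?S t = - (- 2 * k * tanh (k * (t + - x0)) * ?p t)"
        using profile_speed[OF a k, of "t + - x0"] by simp
      then show "((\<lambda>t. - ?p t) has_vector_derivative ?S t) (at t within {x0..x0 + x})"
        using has_vector_derivative_minus[OF p'] by simp
    qed (use that in auto)
    then show "(?S has_integral a - profile a k x) {x0..x0 + x}" by simp
  qed
  show "integral {x0 + x..x0} ?S = a - profile a k x" if "x \<le> 0"
  proof (rule integral_unique)
    have "(?S has_integral ?p x0 - ?p (x0 + x)) {x0 + x..x0}"
    proof (rule fundamental_theorem_of_calculus)
      fix t assume "t \<in> {x0 + x..x0}"
      then have "tanh (k * (t + - x0)) \<le> 0" using k by (simp add: mult_le_0_iff)
      then have "?S t = - 2 * k * tanh (k * (t + - x0)) * ?p t"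
        using profile_speed[OF a k, of "t + - x0"] by (simp add: abs_of_nonpos)
      then show "(?p has_vector_derivative ?S t) (at t within {x0 + x..x0})"
        using p' by simp
    qed (use that in auto)
    then show "(?S has_integral a - profile a k x) {x0 + x..x0}" by simp
  qed
qed

lemma
  assumes a: "a > 0" and k: "k > 0" and v: "primitive g v" and L: "v \<in> L2" "g \<in> L2"
    and mass: "(LINT x|lebesgue. (cmod (v x))\<^sup>2) = 4 * a\<^sup>2 / (3 * k)"
  defines "d \<equiv> 4 * k\<^sup>2 / a"
  defines "e \<equiv> 1 / 2 * (LINT x|lebesgue. (cmod (g x))\<^sup>2) - d / 2 * (LINT x|lebesgue. (cmod (v x)) ^ 3)"
  shows primitive_energy_bound: "- (8/5) * a\<^sup>2 * k \<le> e"
    and primitive_energy_rigidity: "e = - (8/5) * a\<^sup>2 * k \<Longrightarrow>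
      \<exists>c x0. cmod c = 1 \<and> (\<forall>x. v x = c * complex_of_real (profile a k (x - x0)))"
proof -
  have d: "d > 0" using a k by (simp add: d_def)
  obtain x0 where max: "\<And>x. cmod (v x) \<le> cmod (v x0)"
    using primitive_L2_attains_max[OF v L] by blast
  define M where "M = cmod (v x0)"
  have M: "\<And>x. cmod (v x) \<le> M" "cmod (v x0) = M" "M \<ge> 0" using max by (auto simp: M_def)
  define f where "f = sqrt d * (8/15 * M\<^sup>2 * sqrt M) - d / 2 * M * (4 * a\<^sup>2 / (3 * k))"
  define Q where "Q = (LINT x|lebesgue. (cmod (g x) - speed d M (cmod (v x)))\<^sup>2)"
  have f: "f \<ge> - (8/5) * a\<^sup>2 * k" "f = - (8/5) * a\<^sup>2 * k \<Longrightarrow> M = a"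
    using reduced_energy[OF a k M(3)] by (auto simp: f_def d_def)
  have Q: "Q \<ge> 0" unfolding Q_def by (rule integral_nonneg_AE) auto
  have low: "1 / 2 * Q + f \<le> e"
    using energy_completed_square(2)[OF v L d M(1,2)] unfolding mass e_def f_def Q_def by linarith
  show "- (8/5) * a\<^sup>2 * k \<le> e" using low f(1) Q by linarith
  assume "e = - (8/5) * a\<^sup>2 * k"
  with low f(1) Q have "Q = 0" "f = - (8/5) * a\<^sup>2 * k" by linarith+
  then have Ma: "M = a" using f by simp
  have "AE x in lebesgue. (cmod (g x) - speed d a (cmod (v x)))\<^sup>2 = 0"
    using \<open>Q = 0\<close> energy_completed_square(1)[OF v L d M(1,2)] unfolding Q_def Ma
    by (subst (asm) integral_nonneg_eq_0_iff_AE) auto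
  then have gs: "AE x in lebesgue. cmod (g x) = speed d a (cmod (v x))" by eventually_elim auto
  let ?w = "\<lambda>x. cmod (v x)" and ?\<psi> = "\<lambda>x. profile a k (x + - x0)"
  \<comment> \<open>The comparison lemma sees only integrals of the speed, so equality almost
    everywhere is enough.\<close>
  have int_g: "integral {x..y} (\<lambda>t. cmod (g t)) = integral {x..y} (\<lambda>t. speed d a (?w t))" for x y
    by (rule integral_AE_eq[OF gs])
  have ge: "?\<psi> x \<le> ?w x" for x
    using profile_comparison[OF a k primitive_cmod_continuous[OF v], of x0 x]
      cmod_primitive_lipschitz[OF v] M Ma int_g by (simp add: d_def)
  have i2: "integrable lebesgue (\<lambda>x. (?w x)\<^sup>2)" using L by (simp add: L2_def)
  have "(LINT x|lebesgue. (?w x)\<^sup>2 - (?\<psi> x)\<^sup>2) = 0"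
    using mass profile_square_integral[OF a k, of "- x0"] i2 profile_square_integrable[OF a k, of "- x0"]
    by simp
  moreover have "(?\<psi> x)\<^sup>2 \<le> (?w x)\<^sup>2" for x
    using ge[of x] profile_pos[OF a, of k "x + - x0"] by (intro power_mono) auto
  ultimately have "AE x in lebesgue. (?w x)\<^sup>2 - (?\<psi> x)\<^sup>2 = 0"
    using i2 profile_square_integrable[OF a k, of "- x0"]
    by (subst (asm) integral_nonneg_eq_0_iff_AE) auto
  then have "AE x in lebesgue. ?w x = ?\<psi> x"
    by eventually_elim (use profile_pos[OF a] in \<open>simp add: less_imp_le\<close>)
  then have w: "?w x = ?\<psi> x" for x
    by (rule AE_eq_continuous_imp_eq[OF _ primitive_cmod_continuous[OF v] profile_continuous])
  have int_\<psi>: "integral {x..y} (\<lambda>t. cmod (g t)) = integral {x..y} (\<lambda>t. speed d a (?\<psi> t))" for x y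
    unfolding int_g w ..
  \<comment> \<open>The displacement is at most the path length, the integral of |g|, which is now
    known to be the drop of the profile, hence the difference of the moduli.\<close>
  have par: "cmod (v x0 - v x) \<le> cmod (v x0) - cmod (v x)" for x
  proof (cases "x0 \<le> x")
    case True
    have "integral {x0..x} (\<lambda>t. speed d a (?\<psi> t)) = a - ?\<psi> x"
      using integral_speed_profile(1)[OF a k, of "x - x0" x0] True by (simp add: d_def)
    then show ?thesis
      using primitive_norm_diff_le[OF v True] int_\<psi>[of x0 x] w[of x] w[of x0]
      by (simp add: norm_minus_commute)
  next
    case False
    then have "integral {x..x0} (\<lambda>t. speed d a (?\<psi> t)) = a - ?\<psi> x"
      using integral_speed_profile(2)[OF a k, of "x - x0" x0] by (simp add: d_def)
    then show ?thesis
      using primitive_norm_diff_le[OF v, of x x0] False int_\<psi>[of x x0] w[of x] w[of x0] by simp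
  qed
  have "a *\<^sub>R v x = ?\<psi> x *\<^sub>R v x0" for x
    using norm_diff_eq_imp_parallel[OF par, of x] w[of x] w[of x0] by simp
  then have "v x = (v x0 / complex_of_real a) * complex_of_real (profile a k (x - x0))" for x
    using a by (simp add: scaleR_conv_of_real field_simps)
  moreover have "cmod (v x0 / complex_of_real a) = 1"
    using a w[of x0] by (simp add: norm_divide)
  ultimately show "\<exists>c x0. cmod c = 1 \<and> (\<forall>x. v x = c * complex_of_real (profile a k (x - x0)))"
    by blast
qed

section \<open>Scalar bound, rigidity and attainment in H1\<close>

lemma L2_norm_squared: "(L2_norm u)\<^sup>2 = (LINT x|lebesgue. (cmod (u x))\<^sup>2)"
  unfolding L2_norm_def by (rule real_sqrt_pow2) (rule integral_nonneg_AE, simp)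

lemma H1_measurable: "u \<in> H1 \<Longrightarrow> u \<in> borel_measurable lebesgue"
  by (simp add: H1_def L2_def)

lemma H1_cube_integrable:
  assumes u: "u \<in> H1"
  shows "integrable lebesgue (\<lambda>x. (cmod (u x)) ^ 3)"
proof -
  obtain v g where v: "primitive g v" "AE x in lebesgue. u x = v x" "v \<in> L2" "g \<in> L2"
    using H1_E[OF u] by metis
  have vm: "v \<in> borel_measurable lebesgue" using v by (simp add: L2_def)
  obtain x0 where "\<And>x. cmod (v x) \<le> cmod (v x0)"
    using primitive_L2_attains_max[OF v(1,3,4)] by blast
  then have "integrable lebesgue (\<lambda>x. (cmod (v x)) ^ 3)"
    using v(3) by (intro bounded_L2_cube_integrable[of _ "cmod (v x0)"]) (auto simp: L2_def)
  then show ?thesis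
    using H1_measurable[OF u] vm v(2) by (subst integrable_cong_AE[where g = "\<lambda>x. (cmod (v x)) ^ 3"]) auto
qed

lemma
  assumes a: "a > 0" and k: "k > 0" and u: "u \<in> H1" and mass: "(L2_norm u)\<^sup>2 = 4 * a\<^sup>2 / (3 * k)"
  shows scalar_energy_bound: "- (8/5) * a\<^sup>2 * k \<le> scalar_energy (6 * k\<^sup>2 / a) u"
    and scalar_energy_rigidity: "scalar_energy (6 * k\<^sup>2 / a) u = - (8/5) * a\<^sup>2 * k \<Longrightarrow>
      \<exists>\<theta> y. AE x in lebesgue. u x = exp (\<i> * complex_of_real \<theta>) * complex_of_real (profile a k (x + y))"
proof -
  obtain v g where v: "primitive g v" "AE x in lebesgue. u x = v x" "v \<in> L2" "g \<in> L2"
    and D: "(LINT x|lebesgue. (cmod (weak_deriv u x))\<^sup>2) = (LINT x|lebesgue. (cmod (g x))\<^sup>2)"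
    using H1_E[OF u] .
  have vm: "v \<in> borel_measurable lebesgue" using v by (simp add: L2_def)
  have "(LINT x|lebesgue. (cmod (u x)) ^ n) = (LINT x|lebesgue. (cmod (v x)) ^ n)" for n
    using H1_measurable[OF u] vm v(2) by (intro integral_cong_AE) auto
  then have m: "(LINT x|lebesgue. (cmod (v x))\<^sup>2) = 4 * a\<^sup>2 / (3 * k)"
    and E: "scalar_energy (6 * k\<^sup>2 / a) u = 1 / 2 * (LINT x|lebesgue. (cmod (g x))\<^sup>2)
      - 4 * k\<^sup>2 / a / 2 * (LINT x|lebesgue. (cmod (v x)) ^ 3)"
    using mass by (auto simp: L2_norm_squared scalar_energy_def D)
  show "- (8/5) * a\<^sup>2 * k \<le> scalar_energy (6 * k\<^sup>2 / a) u"
    unfolding E by (rule primitive_energy_bound[OF a k v(1,3,4) m])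
  assume "scalar_energy (6 * k\<^sup>2 / a) u = - (8/5) * a\<^sup>2 * k"
  then obtain c x0 where c: "cmod c = 1" "\<And>x. v x = c * complex_of_real (profile a k (x - x0))"
    using primitive_energy_rigidity[OF a k v(1,3,4) m] unfolding E by blast
  obtain \<theta> where \<theta>: "c = exp (\<i> * complex_of_real \<theta>)"
    using c(1) complex_norm_eq_1_exp[of c] by metis
  have "AE x in lebesgue. u x = exp (\<i> * complex_of_real \<theta>) * complex_of_real (profile a k (x + - x0))"
    using v(2) by eventually_elim (simp add: c(2) \<theta>)
  then show "\<exists>\<theta> y. AE x in lebesgue. u x = exp (\<i> * complex_of_real \<theta>) * complex_of_real (profile a k (x + y))"
    by blast
qed

lemma
  assumes a: "a > 0" and k: "k > 0" and c: "cmod c = 1"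
    and u: "AE x in lebesgue. u x = c * complex_of_real (profile a k (x + y))"
  shows profile_H1: "u \<in> H1"
    and profile_mass: "(L2_norm u)\<^sup>2 = 4 * a\<^sup>2 / (3 * k)"
    and profile_scalar_energy: "scalar_energy (6 * k\<^sup>2 / a) u = - (8/5) * a\<^sup>2 * k"
proof -
  let ?\<psi> = "\<lambda>x. profile a k (x + y)" and ?\<psi>' = "\<lambda>x. - 2 * k * tanh (k * (x + y)) * profile a k (x + y)"
  let ?v = "\<lambda>x. c * complex_of_real (?\<psi> x)" and ?g = "\<lambda>x. c * complex_of_real (?\<psi>' x)"
  have c\<psi>: "continuous_on UNIV ?\<psi>" and c\<psi>': "continuous_on UNIV ?\<psi>'"
    by (intro continuous_intros profile_continuous; simp)+
  have "primitive (\<lambda>x. complex_of_real (?\<psi>' x)) (\<lambda>x. complex_of_real (?\<psi> x))"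
    by (intro primitiveI_derivative profile_derivative c\<psi>')
  moreover have "primitive (\<lambda>x. 0) (\<lambda>x. c)"
    by (simp add: primitive_def locally_integrable_def)
  ultimately have v: "primitive ?g ?v"
    using primitive_mult[of "\<lambda>x. 0" "\<lambda>x. c"] by fastforce
  have cv: "cmod (?v x) = ?\<psi> x" and cg: "(cmod (?g x))\<^sup>2 = (?\<psi>' x)\<^sup>2" for x
    using c profile_pos[OF a, of k "x + y"] by (auto simp: norm_mult power_mult_distrib)
  have vm: "?v \<in> borel_measurable lebesgue" and gm: "?g \<in> borel_measurable lebesgue"
    by (intro measurable_lebesgue_continuous continuous_intros c\<psi> c\<psi>')+
  have gL: "?g \<in> L2"
    using gm profile_derivative_square_integrable[OF a k, of y] unfolding L2_def mem_Collect_eq cg by blast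
  have vL: "?v \<in> L2"
    using vm profile_square_integrable[OF a k, of y] unfolding L2_def mem_Collect_eq cv by blast
  have vu: "AE x in lebesgue. ?v x = u x" using u by eventually_elim simp
  have wu: "has_weak_deriv u ?g"
    by (rule has_weak_deriv_cong_AE[OF primitive_imp_weak_deriv[OF v] vu])
  have um: "u \<in> borel_measurable lebesgue" by (rule borel_measurable_AE[OF vm vu])
  have "integrable lebesgue (\<lambda>x. (cmod (u x))\<^sup>2) \<longleftrightarrow> integrable lebesgue (\<lambda>x. (cmod (?v x))\<^sup>2)"
    using um vm vu by (intro integrable_cong_AE) auto
  then have uL: "u \<in> L2" using um vL unfolding L2_def by blast
  with wu gL show "u \<in> H1" unfolding H1_def by blast
  have pow: "(LINT x|lebesgue. (cmod (u x)) ^ n) = (LINT x|lebesgue. (?\<psi> x) ^ n)" for n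
  proof -
    have "(LINT x|lebesgue. (cmod (u x)) ^ n) = (LINT x|lebesgue. (cmod (?v x)) ^ n)"
      using um vm vu by (intro integral_cong_AE) auto
    then show ?thesis unfolding cv .
  qed
  show "(L2_norm u)\<^sup>2 = 4 * a\<^sup>2 / (3 * k)"
    using profile_square_integral[OF a k, of y] by (simp only: L2_norm_squared pow)
  have "(LINT x|lebesgue. (cmod (weak_deriv u x))\<^sup>2) = 16 / 15 * a\<^sup>2 * k"
    unfolding weak_deriv_square_integral[OF wu gm] cg by (rule profile_derivative_square_integral[OF a k])
  moreover have "6 * k\<^sup>2 / a / 3 * (LINT x|lebesgue. (?\<psi> x) ^ 3) = 32 / 15 * a\<^sup>2 * k"
    using profile_cube_integral[OF a k, of y] by simp
  ultimately show "scalar_energy (6 * k\<^sup>2 / a) u = - (8/5) * a\<^sup>2 * k"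
    unfolding scalar_energy_def pow by simp
qed

section \<open>The coupling term\<close>

text \<open>The pointwise defect in the inequality of means combined with the bound of a real part
  by the modulus. Recording it as a function makes the case of equality accessible.\<close>

definition coupling_gap :: "triple \<Rightarrow> real \<Rightarrow> real" where
  "coupling_gap = (\<lambda>(u1, u2, u3) x. ((cmod (u1 x)) ^ 3 + (cmod (u2 x)) ^ 3 + (cmod (u3 x)) ^ 3) / 3
     - Re (u1 x * u2 x * cnj (u3 x)))"

text \<open>Exhibits the inequality of means for three nonnegative numbers together with its case of
  equality.\<close>

lemma cubes_identity:
  fixes x y z :: real
  shows "(x ^ 3 + y ^ 3 + z ^ 3) / 3 - x * y * z = (x + y + z) * ((x - y)\<^sup>2 + (y - z)\<^sup>2 + (z - x)\<^sup>2) / 6"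
  by (simp add: algebra_simps power2_eq_square power3_eq_cube)

lemma Re_product_le: "Re (x * y * cnj z) \<le> cmod x * cmod y * cmod z"
  using complex_Re_le_cmod[of "x * y * cnj z"] by (simp add: norm_mult)

lemma product_le_cubes:
  fixes x y z :: real
  assumes "0 \<le> x" "0 \<le> y" "0 \<le> z"
  shows "x * y * z \<le> (x ^ 3 + y ^ 3 + z ^ 3) / 3"
proof -
  have "0 \<le> (x + y + z) * ((x - y)\<^sup>2 + (y - z)\<^sup>2 + (z - x)\<^sup>2) / 6"
    by (intro divide_nonneg_nonneg mult_nonneg_nonneg add_nonneg_nonneg) (use assms in auto)
  then show ?thesis using cubes_identity[of x y z] by linarith
qed

lemma coupling_gap_nonneg: "0 \<le> coupling_gap (u1, u2, u3) x"
  unfolding coupling_gap_def prod.case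
  using Re_product_le[of "u1 x" "u2 x" "u3 x"]
    product_le_cubes[OF norm_ge_zero norm_ge_zero norm_ge_zero, of "u1 x" "u2 x" "u3 x"]
  by linarith

text \<open>The gap is a sum of two nonnegative defects, one measuring unequal moduli and one
  measuring misaligned phases; both must vanish.\<close>

lemma coupling_gap_eq_0:
  assumes "coupling_gap (u1, u2, u3) x = 0"
  shows "cmod (u1 x) = cmod (u2 x)" "cmod (u2 x) = cmod (u3 x)"
    "Re (u1 x * u2 x * cnj (u3 x)) = cmod (u1 x) * cmod (u2 x) * cmod (u3 x)"
proof -
  let ?x = "cmod (u1 x)" and ?y = "cmod (u2 x)" and ?z = "cmod (u3 x)"
  let ?P = "(?x + ?y + ?z) * ((?x - ?y)\<^sup>2 + (?y - ?z)\<^sup>2 + (?z - ?x)\<^sup>2) / 6"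
  have P: "?P \<ge> 0" by (intro divide_nonneg_nonneg mult_nonneg_nonneg add_nonneg_nonneg) auto
  have "?P + (?x * ?y * ?z - Re (u1 x * u2 x * cnj (u3 x))) = 0"
    using assms cubes_identity[of ?x ?y ?z] unfolding coupling_gap_def prod.case by linarith
  then have "?P = 0" and re: "Re (u1 x * u2 x * cnj (u3 x)) = ?x * ?y * ?z"
    using P Re_product_le[of "u1 x" "u2 x" "u3 x"] by linarith+
  show "Re (u1 x * u2 x * cnj (u3 x)) = ?x * ?y * ?z" by (rule re)
  from \<open>?P = 0\<close> have "?x + ?y + ?z = 0 \<or> (?x - ?y)\<^sup>2 + (?y - ?z)\<^sup>2 + (?z - ?x)\<^sup>2 = 0" by simp
  then have "?x = ?y \<and> ?y = ?z"
  proof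
    assume "?x + ?y + ?z = 0"
    then have "?x = 0" "?y = 0" "?z = 0"
      using norm_ge_zero[of "u1 x"] norm_ge_zero[of "u2 x"] norm_ge_zero[of "u3 x"] by linarith+
    then show ?thesis by simp
  next
    assume "(?x - ?y)\<^sup>2 + (?y - ?z)\<^sup>2 + (?z - ?x)\<^sup>2 = 0"
    then have "(?x - ?y)\<^sup>2 = 0" "(?y - ?z)\<^sup>2 = 0"
      using zero_le_power2[of "?x - ?y"] zero_le_power2[of "?y - ?z"] zero_le_power2[of "?z - ?x"] by linarith+
    then show ?thesis by simp
  qed
  then show "?x = ?y" "?y = ?z" by auto
qed

text \<open>An exact identity: the cubes inside the gap, with factor \<alpha> / 3, are what raises
  the scalar coupling from \<beta> to \<alpha> + \<beta>. It decouples the three components up to a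
  nonnegative remainder.\<close>

lemma
  assumes u: "u1 \<in> H1" "u2 \<in> H1" "u3 \<in> H1"
  shows coupling_gap_integrable: "integrable lebesgue (coupling_gap (u1, u2, u3))"
    and energy_decomposition: "energy \<alpha> \<beta> (u1, u2, u3) =
      scalar_energy (\<alpha> + \<beta>) u1 + scalar_energy (\<alpha> + \<beta>) u2 + scalar_energy (\<alpha> + \<beta>) u3
      + \<alpha> * (LINT x|lebesgue. coupling_gap (u1, u2, u3) x)"
proof -
  note c = H1_cube_integrable[OF u(1)] H1_cube_integrable[OF u(2)] H1_cube_integrable[OF u(3)]
  note m = H1_measurable[OF u(1)] H1_measurable[OF u(2)] H1_measurable[OF u(3)]
  have i: "integrable lebesgue (\<lambda>x. u1 x * u2 x * cnj (u3 x))"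
  proof (rule Bochner_Integration.integrable_bound)
    let ?h = "\<lambda>x. ((cmod (u1 x)) ^ 3 + (cmod (u2 x)) ^ 3 + (cmod (u3 x)) ^ 3) / 3"
    show "integrable lebesgue ?h" using c by auto
    have "norm (u1 x * u2 x * cnj (u3 x)) \<le> norm (?h x)" for x
      using product_le_cubes[of "cmod (u1 x)" "cmod (u2 x)" "cmod (u3 x)"]
      unfolding norm_mult complex_mod_cnj real_norm_def by (rule order_trans[OF _ abs_ge_self]) auto
    then show "AE x in lebesgue. norm (u1 x * u2 x * cnj (u3 x)) \<le> norm (?h x)" by (rule AE_I2)
    show "(\<lambda>x. u1 x * u2 x * cnj (u3 x)) \<in> borel_measurable lebesgue"
      using m by (intro borel_measurable_times borel_measurable_continuous_on[OF continuous_on_cnj[OF continuous_on_id]]) auto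
  qed
  have iR: "integrable lebesgue (\<lambda>x. Re (u1 x * u2 x * cnj (u3 x)))" by (rule integrable_Re[OF i])
  have ic: "integrable lebesgue (\<lambda>x. ((cmod (u1 x)) ^ 3 + (cmod (u2 x)) ^ 3 + (cmod (u3 x)) ^ 3) / 3)"
    using c by auto
  show gap: "integrable lebesgue (coupling_gap (u1, u2, u3))"
    unfolding coupling_gap_def prod.case by (rule Bochner_Integration.integrable_diff[OF ic iR])
  have "(LINT x|lebesgue. coupling_gap (u1, u2, u3) x) =
      ((LINT x|lebesgue. (cmod (u1 x)) ^ 3) + (LINT x|lebesgue. (cmod (u2 x)) ^ 3) + (LINT x|lebesgue. (cmod (u3 x)) ^ 3)) / 3
      - Re (LINT x|lebesgue. u1 x * u2 x * cnj (u3 x))"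
    unfolding coupling_gap_def prod.case Bochner_Integration.integral_diff[OF ic iR] integral_Re[OF i]
    using c by simp
  then show "energy \<alpha> \<beta> (u1, u2, u3) =
      scalar_energy (\<alpha> + \<beta>) u1 + scalar_energy (\<alpha> + \<beta>) u2 + scalar_energy (\<alpha> + \<beta>) u3
      + \<alpha> * (LINT x|lebesgue. coupling_gap (u1, u2, u3) x)"
    by (simp only: energy.simps scalar_energy_def) (simp add: algebra_simps add_divide_distrib)
qed

section \<open>Minimizers of the coupled energy\<close>

lemma AE_profile_translates_eq:
  assumes a: "a > 0" and k: "k > 0"
    and eq: "AE x in lebesgue. profile a k (x + y) = profile a k (x + z)"
  shows "y = z"
proof (rule ccontr)
  assume "y \<noteq> z"
  \<comment> \<open>At the centre of the second profile its value is \<open>a\<close>, which the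
    first one takes only at its own centre.\<close>
  have "profile a k (- z + y) = profile a k (- z + z)"
    using AE_eq_continuous_imp_eq[OF eq profile_continuous profile_continuous] .
  with profile_less[OF a k, of "- z + y"] \<open>y \<noteq> z\<close> show False by simp
qed

lemma unimodular_Re_eq_1: "cmod z = 1 \<Longrightarrow> Re z = 1 \<Longrightarrow> z = 1"
  by (simp add: complex_eq_iff cmod_def)

text \<open>Equal moduli force a common centre, and aligned phases force the third to be the sum of
  the others. Phases matter only modulo 2 pi, so the last conclusion compares exponentials.\<close>

lemma coupled_profiles:
  assumes a: "a > 0" and k: "k > 0"
    and u: "AE x in lebesgue. u1 x = exp (\<i> * complex_of_real t1) * complex_of_real (profile a k (x + y1))"
      "AE x in lebesgue. u2 x = exp (\<i> * complex_of_real t2) * complex_of_real (profile a k (x + y2))"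
      "AE x in lebesgue. u3 x = exp (\<i> * complex_of_real t3) * complex_of_real (profile a k (x + y3))"
    and gap: "AE x in lebesgue. coupling_gap (u1, u2, u3) x = 0"
  shows "y1 = y2" "y2 = y3" "exp (\<i> * complex_of_real t3) = exp (\<i> * complex_of_real (t1 + t2))"
proof -
  have pos: "\<bar>profile a k x\<bar> = profile a k x" for x using profile_pos[OF a, of k x] by simp
  have "AE x in lebesgue. profile a k (x + y1) = profile a k (x + y2)"
    using u(1,2) gap
  proof eventually_elim
    case (elim x)
    show ?case
      using coupling_gap_eq_0(1)[OF elim(3)] unfolding elim(1,2) by (simp add: norm_mult pos)
  qed
  then show y12: "y1 = y2" by (rule AE_profile_translates_eq[OF a k])
  have "AE x in lebesgue. profile a k (x + y2) = profile a k (x + y3)"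
    using u(2,3) gap
  proof eventually_elim
    case (elim x)
    show ?case
      using coupling_gap_eq_0(2)[OF elim(3)] unfolding elim(1,2) by (simp add: norm_mult pos)
  qed
  then show y23: "y2 = y3" by (rule AE_profile_translates_eq[OF a k])
  \<comment> \<open>The phase mismatch, constant in x; it has modulus 1, so it is 1 as soon as its
    real part is.\<close>
  define z where "z = exp (\<i> * complex_of_real t1) * exp (\<i> * complex_of_real t2) * cnj (exp (\<i> * complex_of_real t3))"
  have z1: "cmod z = 1" by (simp add: z_def norm_mult)
  have "AE x in lebesgue. Re z * (profile a k (x + y3)) ^ 3 = (profile a k (x + y3)) ^ 3"
    using u gap
  proof eventually_elim
    case (elim x)
    let ?p = "profile a k (x + y3)"
    have "u1 x * u2 x * cnj (u3 x) = z * complex_of_real (?p ^ 3)"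
      using elim by (simp add: z_def y12 y23 power3_eq_cube mult_ac)
    then have "Re (u1 x * u2 x * cnj (u3 x)) = Re z * ?p ^ 3" by simp
    moreover have "cmod (u1 x) = ?p" "cmod (u2 x) = ?p" "cmod (u3 x) = ?p"
      using elim pos y12 y23 by (auto simp: norm_mult)
    ultimately show ?case using coupling_gap_eq_0(3)[OF elim(4)] by (simp add: power3_eq_cube)
  qed
  \<comment> \<open>Any point would do, as the profile is positive everywhere; continuity permits
    evaluation at a single point.\<close>
  then have "Re z * (profile a k (0 + y3)) ^ 3 = (profile a k (0 + y3)) ^ 3"
    by (rule AE_eq_continuous_imp_eq) (intro continuous_intros profile_continuous)+
  then have "Re z = 1" using profile_pos[OF a, of k "0 + y3"] by simp
  with z1 have "z = 1" by (rule unimodular_Re_eq_1)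
  let ?e3 = "exp (\<i> * complex_of_real t3)"
  have "cnj ?e3 * ?e3 = 1" by (simp add: exp_cnj flip: exp_add)
  then have "z * ?e3 = exp (\<i> * complex_of_real t1) * exp (\<i> * complex_of_real t2)"
    by (simp add: z_def mult.assoc)
  then show "?e3 = exp (\<i> * complex_of_real (t1 + t2))"
    using \<open>z = 1\<close> by (simp add: distrib_left exp_add)
qed

lemma minimizers_profile:
  assumes \<alpha>: "\<alpha> > 0" and a: "a > 0" and k: "k > 0" and sum: "\<alpha> + \<beta> = 6 * k\<^sup>2 / a"
  defines "m \<equiv> 4 * a\<^sup>2 / (3 * k)"
  shows "minimizers \<alpha> \<beta> m m m = {(u1, u2, u3). \<exists>\<theta>1 \<theta>2 y :: real.
       (AE x in lebesgue. u1 x = exp (\<i> * complex_of_real \<theta>1) * complex_of_real (profile a k (x + y))) \<and>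
       (AE x in lebesgue. u2 x = exp (\<i> * complex_of_real \<theta>2) * complex_of_real (profile a k (x + y))) \<and>
       (AE x in lebesgue. u3 x = exp (\<i> * complex_of_real (\<theta>1 + \<theta>2)) * complex_of_real (profile a k (x + y)))}"
    (is "_ = ?S")
proof -
  define E0 where "E0 = 3 * (- (8/5) * a\<^sup>2 * k)"
  have gap0: "0 \<le> (LINT x|lebesgue. coupling_gap (u1, u2, u3) x)" for u1 u2 u3
    by (rule integral_nonneg_AE) (simp add: coupling_gap_nonneg)
  have low: "E0 \<le> energy \<alpha> \<beta> u" if u: "u \<in> admissible m m m" for u
  proof -
    obtain u1 u2 u3 where u': "u = (u1, u2, u3)" "u1 \<in> H1" "u2 \<in> H1" "u3 \<in> H1"
      "(L2_norm u1)\<^sup>2 = m" "(L2_norm u2)\<^sup>2 = m" "(L2_norm u3)\<^sup>2 = m"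
      using u by (auto simp: admissible_def)
    have "\<alpha> * (LINT x|lebesgue. coupling_gap (u1, u2, u3) x) \<ge> 0" using \<alpha> gap0 by simp
    then show ?thesis
      unfolding u'(1) energy_decomposition[OF u'(2-4)] sum E0_def
      using scalar_energy_bound[OF a k u'(2)] scalar_energy_bound[OF a k u'(3)]
        scalar_energy_bound[OF a k u'(4)] u'(5-7) unfolding m_def by linarith
  qed
  have S: "u \<in> admissible m m m \<and> energy \<alpha> \<beta> u = E0" if uS: "u \<in> ?S" for u
  proof -
    obtain u1 u2 u3 t1 t2 y where u': "u = (u1, u2, u3)"
      and ae: "AE x in lebesgue. u1 x = exp (\<i> * complex_of_real t1) * complex_of_real (profile a k (x + y))"
        "AE x in lebesgue. u2 x = exp (\<i> * complex_of_real t2) * complex_of_real (profile a k (x + y))"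
        "AE x in lebesgue. u3 x = exp (\<i> * complex_of_real (t1 + t2)) * complex_of_real (profile a k (x + y))"
      using uS by auto
    have unit: "cmod (exp (\<i> * complex_of_real t)) = 1" for t by simp
    note H = profile_H1[OF a k unit ae(1)] profile_H1[OF a k unit ae(2)] profile_H1[OF a k unit ae(3)]
    note mass = profile_mass[OF a k unit ae(1)] profile_mass[OF a k unit ae(2)] profile_mass[OF a k unit ae(3)]
    note en = profile_scalar_energy[OF a k unit ae(1)] profile_scalar_energy[OF a k unit ae(2)]
      profile_scalar_energy[OF a k unit ae(3)]
    have "AE x in lebesgue. coupling_gap (u1, u2, u3) x = 0"
      using ae
    proof eventually_elim
      case (elim x)
      let ?p = "profile a k (x + y)"
      let ?e = "\<lambda>t. exp (\<i> * complex_of_real t)"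
      have "?e t1 * ?e t2 * cnj (?e (t1 + t2)) = 1"
        by (simp add: exp_cnj distrib_left flip: exp_add)
      then have "?e t1 * of_real ?p * (?e t2 * of_real ?p) * cnj (?e (t1 + t2) * of_real ?p) = complex_of_real (?p ^ 3)"
        by (simp add: power3_eq_cube mult_ac)
      then have "Re (u1 x * u2 x * cnj (u3 x)) = ?p ^ 3"
        unfolding elim by (metis Re_complex_of_real)
      moreover have "cmod (u1 x) = ?p" "cmod (u2 x) = ?p" "cmod (u3 x) = ?p"
        using elim profile_pos[OF a, of k "x + y"] by (auto simp: norm_mult)
      ultimately show ?case by (simp only: coupling_gap_def prod.case) simp
    qed
    then have "(LINT x|lebesgue. coupling_gap (u1, u2, u3) x) = 0"
      by (rule integral_eq_zero_AE)
    then have "energy \<alpha> \<beta> u = E0"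
      unfolding u' energy_decomposition[OF H] sum en E0_def by simp
    with H mass show ?thesis by (simp add: u' admissible_def m_def)
  qed
  \<comment> \<open>One member of the right-hand side is enough to see that the lower bound
    \<open>E0\<close> is attained and hence is the infimum.\<close>
  have "((\<lambda>x. exp (\<i> * complex_of_real 0) * complex_of_real (profile a k (x + 0))),
      (\<lambda>x. exp (\<i> * complex_of_real 0) * complex_of_real (profile a k (x + 0))),
      (\<lambda>x. exp (\<i> * complex_of_real (0 + 0)) * complex_of_real (profile a k (x + 0)))) \<in> ?S"
    by blast
  from S[OF this] obtain u0 where u0: "u0 \<in> admissible m m m" "energy \<alpha> \<beta> u0 = E0" by blast
  have min: "min_energy \<alpha> \<beta> m m m = ereal E0"
    unfolding min_energy_def
  proof (rule antisym)
    show "(INF u\<in>admissible m m m. ereal (energy \<alpha> \<beta> u)) \<le> ereal E0"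
      using INF_lower[OF u0(1), of "\<lambda>u. ereal (energy \<alpha> \<beta> u)"] u0(2) by simp
    show "ereal E0 \<le> (INF u\<in>admissible m m m. ereal (energy \<alpha> \<beta> u))"
      by (rule INF_greatest) (simp add: low)
  qed
  show ?thesis
  proof (intro equalityI subsetI)
    fix u assume "u \<in> ?S"
    then show "u \<in> minimizers \<alpha> \<beta> m m m"
      using S[of u] min by (simp add: minimizers_def)
  next
    fix u assume "u \<in> minimizers \<alpha> \<beta> m m m"
    then have u: "u \<in> admissible m m m" "energy \<alpha> \<beta> u = E0" by (auto simp: minimizers_def min)
    obtain u1 u2 u3 where u': "u = (u1, u2, u3)" "u1 \<in> H1" "u2 \<in> H1" "u3 \<in> H1"
      "(L2_norm u1)\<^sup>2 = 4 * a\<^sup>2 / (3 * k)" "(L2_norm u2)\<^sup>2 = 4 * a\<^sup>2 / (3 * k)"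
      "(L2_norm u3)\<^sup>2 = 4 * a\<^sup>2 / (3 * k)"
      using u by (auto simp: admissible_def m_def)
    let ?I = "LINT x|lebesgue. coupling_gap (u1, u2, u3) x"
    have sumE: "scalar_energy (6 * k\<^sup>2 / a) u1 + scalar_energy (6 * k\<^sup>2 / a) u2
        + scalar_energy (6 * k\<^sup>2 / a) u3 + \<alpha> * ?I = 3 * (- (8/5) * a\<^sup>2 * k)"
      using u(2) unfolding u'(1) energy_decomposition[OF u'(2-4)] sum E0_def .
    \<comment> \<open>Four terms, each bounded below, add up to the sum of their lower bounds, so
      every one of them is sharp.\<close>
    have "\<alpha> * ?I \<ge> 0" using \<alpha> gap0 by simp
    with sumE scalar_energy_bound[OF a k u'(2,5)] scalar_energy_bound[OF a k u'(3,6)]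
      scalar_energy_bound[OF a k u'(4,7)]
    have E: "scalar_energy (6 * k\<^sup>2 / a) u1 = - (8/5) * a\<^sup>2 * k"
      "scalar_energy (6 * k\<^sup>2 / a) u2 = - (8/5) * a\<^sup>2 * k"
      "scalar_energy (6 * k\<^sup>2 / a) u3 = - (8/5) * a\<^sup>2 * k" "\<alpha> * ?I = 0"
      by linarith+
    obtain t1 y1 where 1: "AE x in lebesgue. u1 x = exp (\<i> * complex_of_real t1) * complex_of_real (profile a k (x + y1))"
      using scalar_energy_rigidity[OF a k u'(2,5) E(1)] by blast
    obtain t2 y2 where 2: "AE x in lebesgue. u2 x = exp (\<i> * complex_of_real t2) * complex_of_real (profile a k (x + y2))"
      using scalar_energy_rigidity[OF a k u'(3,6) E(2)] by blast
    obtain t3 y3 where 3: "AE x in lebesgue. u3 x = exp (\<i> * complex_of_real t3) * complex_of_real (profile a k (x + y3))"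
      using scalar_energy_rigidity[OF a k u'(4,7) E(3)] by blast
    have "?I = 0" using E(4) \<alpha> by simp
    then have "AE x in lebesgue. coupling_gap (u1, u2, u3) x = 0"
      using integral_nonneg_eq_0_iff_AE[OF coupling_gap_integrable[OF u'(2-4)]] coupling_gap_nonneg by auto
    note eqs = coupled_profiles[OF a k 1 2 3 this]
    show "u \<in> ?S"
      using 1 2 3 unfolding u'(1) eqs by blast
  qed
qed

theorem theorem1p3:
  fixes \<alpha> \<beta> \<omega> :: real
  assumes "\<alpha> > 0" and "\<beta> > 0" and "\<omega> > 0"
  shows "minimizers \<alpha> \<beta> (soliton_mass \<alpha> \<beta> \<omega>) (soliton_mass \<alpha> \<beta> \<omega>) (soliton_mass \<alpha> \<beta> \<omega>) =
    {(u1, u2, u3). \<exists>\<theta>1 \<theta>2 y :: real.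
       (AE x in lebesgue. u1 x = exp (\<i> * complex_of_real \<theta>1) * complex_of_real (soliton \<alpha> \<beta> \<omega> (x + y))) \<and>
       (AE x in lebesgue. u2 x = exp (\<i> * complex_of_real \<theta>2) * complex_of_real (soliton \<alpha> \<beta> \<omega> (x + y))) \<and>
       (AE x in lebesgue. u3 x = exp (\<i> * complex_of_real (\<theta>1 + \<theta>2)) * complex_of_real (soliton \<alpha> \<beta> \<omega> (x + y)))}"
proof -
  define a k where "a = 3 * \<omega> / (\<alpha> + \<beta>)" and "k = 1 / 2 * sqrt (2 * \<omega>)"
  have pos: "a > 0" "k > 0" using assms by (auto simp: a_def k_def)
  have k2: "k\<^sup>2 = \<omega> / 2" using assms by (simp add: k_def power_mult_distrib power_divide)
  have sum: "\<alpha> + \<beta> = 6 * k\<^sup>2 / a" using assms by (simp add: k2 a_def)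
  have sol: "soliton \<alpha> \<beta> \<omega> x = profile a k x" for x
    by (simp add: soliton_def profile_def a_def k_def)
  have "\<omega> powr (3 / 2) = \<omega> powr (1 + 1 / 2)" by simp
  also have "\<dots> = \<omega> * sqrt \<omega>" using assms by (simp only: powr_add powr_half_sqrt) simp
  finally have pw: "\<omega> powr (3 / 2) = \<omega> * sqrt \<omega>" .
  have mass: "soliton_mass \<alpha> \<beta> \<omega> = 4 * a\<^sup>2 / (3 * k)"
  proof -
    \<comment> \<open>Naming the roots of \<omega> and 2 turns the mass formula into an identity of
      rational functions.\<close>
    define r where "r = sqrt \<omega>"
    have r: "\<omega> = r\<^sup>2" "r > 0" using assms by (auto simp: r_def)
    define q where "q = sqrt (2::real)"
    have q: "q > 0" "q * q = 2" by (auto simp: q_def)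
    have k': "k = q * r / 2" by (simp add: k_def real_sqrt_mult q_def r_def)
    have "4 * (3 * r\<^sup>2 / c)\<^sup>2 / (3 * (q * r / 2)) = 24 * r ^ 3 / (q * c\<^sup>2)" if "c > 0" for c
      using r(2) q(1) that by (simp add: field_simps power2_eq_square power3_eq_cube)
    then have "4 * a\<^sup>2 / (3 * k) = 24 * r ^ 3 / (q * (\<alpha> + \<beta>)\<^sup>2)"
      unfolding a_def k' r(1) using assms by simp
    \<comment> \<open>Splitting 24 as q^2 times 12 moves the root of 2 into the numerator, where
      \<open>soliton_mass\<close> has it.\<close>
    also have "\<dots> = (q * q) * 12 * r ^ 3 / (q * (\<alpha> + \<beta>)\<^sup>2)" by (simp add: q(2))
    also have "\<dots> = 12 * q * r ^ 3 / (\<alpha> + \<beta>)\<^sup>2" using q(1) by simp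
    also have "\<dots> = soliton_mass \<alpha> \<beta> \<omega>"
      unfolding soliton_mass_def pw using r by (simp add: q_def r_def[symmetric] power3_eq_cube power2_eq_square)
    finally show ?thesis by simp
  qed
  show ?thesis
    unfolding mass sol by (rule minimizers_profile[OF assms(1) pos sum])
qed

end
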